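(* Let $G$ be an edge-$\Delta$-critical graph. Then its average degree $\overline{d}(G)$ satisfies $$\overline{d}(G)\ \ge\ \begin{cases} 0.69241\,\Delta-0.15658 & \text{if } \Delta\ge 66,\\ 0.69392\,\Delta-0.20642 & \text{if } \Delta=65,\\ 0.68706\,\Delta+0.19815 & \text{if } 56\le\Delta\le 64.\end{cases}$$
   Context: All graphs are finite and simple. For a graph $G$, $\Delta$ denotes its maximum degree, and $\overline{d}(G)=2|E(G)|/|V(G)|$ its average degree. An edge-$k$-coloring assigns colors from $\{1,\dots,k\}$ to edges so that adjacent edges receive distinct colors; the chromatic index $\chi'(G)$ is the least $k$ for which an edge-$k$-coloring exists. A graph $G$ with maximum degree $\Delta$ is edge-$\Delta$-critical if $\chi'(G)=\Delta+1$ and $\chi'(H)\le\Delta$ for every proper subgraph $H$ of $G$. *)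

theory Defs
  imports Complex_Main
begin

definition simple_graph :: "'a set \<Rightarrow> 'a set set \<Rightarrow> bool" where
  "simple_graph V E \<longleftrightarrow> finite V \<and> (\<forall>e\<in>E. e \<subseteq> V \<and> card e = 2)"

definition vertex_degree :: "'a set set \<Rightarrow> 'a \<Rightarrow> nat" where
  "vertex_degree E v = card {e \<in> E. v \<in> e}"

(* The inserted 0 only matters for V = {}, where Max {} would be unspecified. *)
definition max_degree :: "'a set \<Rightarrow> 'a set set \<Rightarrow> nat" where
  "max_degree V E = Max (insert 0 (vertex_degree E ` V))"

definition average_degree :: "'a set \<Rightarrow> 'a set set \<Rightarrow> real" where
  "average_degree V E = 2 * real (card E) / real (card V)"

definition edge_coloring :: "'a set set \<Rightarrow> nat \<Rightarrow> ('a set \<Rightarrow> nat) \<Rightarrow> bool" where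
  "edge_coloring E k c \<longleftrightarrow>
     (\<forall>e\<in>E. c e \<in> {1..k}) \<and>
     (\<forall>e\<in>E. \<forall>f\<in>E. e \<noteq> f \<and> e \<inter> f \<noteq> {} \<longrightarrow> c e \<noteq> c f)"

(* A suitable k exists whenever E is finite, in particular for every simple_graph V E. *)
definition chromatic_index :: "'a set set \<Rightarrow> nat" where
  "chromatic_index E = (LEAST k. \<exists>c. edge_coloring E k c)"

definition proper_subgraph ::
    "'a set \<Rightarrow> 'a set set \<Rightarrow> 'a set \<Rightarrow> 'a set set \<Rightarrow> bool" where
  "proper_subgraph W F V E \<longleftrightarrow>
     simple_graph W F \<and> W \<subseteq> V \<and> F \<subseteq> E \<and> (W, F) \<noteq> (V, E)"

(* Deleting an isolated vertex already gives a proper subgraph, so critical graphs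
   have no isolated vertices. *)
definition edge_critical :: "nat \<Rightarrow> 'a set \<Rightarrow> 'a set set \<Rightarrow> bool" where
  "edge_critical \<Delta> V E \<longleftrightarrow>
     simple_graph V E \<and> max_degree V E = \<Delta> \<and> chromatic_index E = \<Delta> + 1 \<and>
     (\<forall>W F. proper_subgraph W F V E \<longrightarrow> chromatic_index F \<le> \<Delta>)"

end

theory Submission
  imports Defs
begin

text \<open>
  Fix an edge \<open>xy\<close> of a \<open>\<Delta>\<close>-critical graph and a coloring of \<open>G - xy\<close> with \<open>\<Delta>\<close> colors. If a color
  joins \<open>y\<close> to a vertex \<open>u\<close> and a neighbour \<open>z\<close> of \<open>x\<close> whose edge to \<open>x\<close> can be uncolored to a vertex
  \<open>u'\<close>, then Kempe changes show that \<open>u\<close> and \<open>u'\<close> cannot both have degree at most \<open>\<Delta> - d(x)\<close>. Hence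
  the numbers of such low vertices around \<open>y\<close> and around \<open>z\<close> add up to at most \<open>d(x)\<close>, as in
  Woodall's proof of the bound \<open>2/3 (\<Delta> + 1)\<close>. Sharing the surplus \<open>d(y) - q\<close> of every vertex \<open>y\<close>
  among its neighbours of degree below \<open>q\<close> then brings \<open>x\<close> up to charge \<open>d(x) + 2 (\<Delta> - q)\<close>.

  This suffices unless \<open>d(x)\<close> is very small or larger than \<open>\<Delta> - q\<close>. If it is very small, then a
  Kierstead path argument shows that for each color only boundedly many vertices at distance two
  from \<open>x\<close> are joined by it to a vertex of degree below \<open>q\<close>. So most of them have no
  such neighbour, and they can pass their surplus on to \<open>x\<close> through the neighbours of \<open>x\<close>. If
  \<open>d(x) > \<Delta> - q\<close>, one lets vertices of degree close to \<open>q\<close> receive charge at a lower rate.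
\<close>

subsection \<open>Orbits of two involutions\<close>

text \<open>Let \<open>q\<close> be the claimed average degree and \<open>b = \<Delta> - q\<close>,
  the surplus of a vertex of degree \<open>\<Delta>\<close>. Suppose that all neighbours of
  \<open>x\<close> have degree \<open>\<Delta>\<close>. One with \<open>n\<close> neighbours below
  \<open>q\<close> can give each of them \<open>b / n\<close>, and the bound on pairs of neighbours
  makes the sum of \<open>1 / n\<close> around \<open>x\<close> at least 2. So an \<open>x\<close>
  of degree up to about \<open>b\<close> gets \<open>2 * b\<close>, which is enough only if
  \<open>dg x\<close> is at least \<open>q - 2 * b\<close>. This is the barrier at two thirds: once
  \<open>q\<close> exceeds \<open>2 * b\<close>, vertices of smaller degree need charge from further
  away. At the other end, a vertex below \<open>q\<close> is certain to be low for \<open>x\<close>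
  only while \<open>dg x\<close> is at most about \<open>b\<close>. For larger \<open>x\<close> the
  set being counted has to shrink. The vertices just below \<open>q\<close> are taken out of it and
  need a share of their own, modest enough not to starve the others. The constants balance these
  demands for \<open>q / b\<close> up to 2.2512.\<close>

definition orb :: "('a \<Rightarrow> 'a) \<Rightarrow> ('a \<Rightarrow> 'a) \<Rightarrow> 'a \<Rightarrow> 'a set" where
  "orb f g v = {u. (v, u) \<in> {(a, b). b = f a \<or> b = g a}\<^sup>*}"

lemma orb_refl: "v \<in> orb f g v"
  by (simp add: orb_def)

lemma orb_closed:
  assumes "u \<in> orb f g v" shows "f u \<in> orb f g v" "g u \<in> orb f g v"
  using assms by (auto simp: orb_def intro: rtrancl_into_rtrancl)

lemma orb_least:
  assumes "v \<in> C" "\<And>u. u \<in> C \<Longrightarrow> f u \<in> C \<and> g u \<in> C"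
  shows "orb f g v \<subseteq> C"
proof
  fix u assume "u \<in> orb f g v"
  then have "(v, u) \<in> {(a, b). b = f a \<or> b = g a}\<^sup>*" by (simp add: orb_def)
  then show "u \<in> C" by induction (use assms in auto)
qed

lemma orb_swap: "orb f g v = orb g f v"
  by (rule arg_cong[where f = "\<lambda>R. {u. (v, u) \<in> R\<^sup>*}" and x = "{(a, b). b = f a \<or> b = g a}"
        and y = "{(a, b). b = g a \<or> b = f a}", folded orb_def]) auto

text \<open>The walk starts with \<open>f\<close> because it is used from a fixed point of
  \<open>g\<close>, where the other direction leads nowhere; a one-sided walk then sweeps the whole
  orbit.\<close>

fun walk :: "('a \<Rightarrow> 'a) \<Rightarrow> ('a \<Rightarrow> 'a) \<Rightarrow> 'a \<Rightarrow> nat \<Rightarrow> 'a" where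
  "walk f g v 0 = v"
| "walk f g v (Suc n) = (if even n then f else g) (walk f g v n)"

text \<open>An orbit is a path or a cycle, and only the ends of a path are fixed points.\<close>

lemma orb_ends_aux:
  assumes f: "\<And>v. f (f v) = v" and g: "\<And>v. g (g v) = v"
    and v: "g v = v"
    and u: "u \<in> orb f g v" "f u = u \<or> g u = u" "u \<noteq> v"
    and w: "w \<in> orb f g v" "f w = w \<or> g w = w" "w \<noteq> v"
  shows "u = w"
proof -
  let ?p = "walk f g v"
  have cl: "orb f g v \<subseteq> range ?p"
  proof (rule orb_least)
    show "v \<in> range ?p" by (rule range_eqI[of _ _ 0]) simp
    fix a assume "a \<in> range ?p"
    then obtain n where n: "a = ?p n" by auto
    have nx: "(if even n then f else g) a = ?p (Suc n)" by (simp add: n)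
    have pr: "(if even n then g else f) a \<in> range ?p"
    proof (cases n)
      case 0 then show ?thesis using v n by (metis even_zero rangeI walk.simps(1))
    next
      case (Suc m)
      then have "(if even n then g else f) a = ?p m" using n f g by simp
      then show ?thesis by simp
    qed
    show "f a \<in> range ?p \<and> g a \<in> range ?p"
      using nx pr by (cases "even n") (auto simp del: walk.simps)
  qed
  \<comment> \<open>\<open>u\<close> is an end other than \<open>v\<close>, so the walk stalls at
    \<open>u\<close>, either on the step out of it or already on the step into it.\<close>
  have stop: "\<exists>n. ?p n = ?p (Suc n)"
  proof -
    obtain n where n: "u = ?p n" using cl u by auto
    show ?thesis
    proof (cases n)
      case 0 then show ?thesis using n u by simp
    next
      case (Suc m)
      show ?thesis
      proof (cases "(if even n then f else g) u = u")
        case True then show ?thesis using n by (metis walk.simps(2))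
      next
        case False
        then have "(if even m then f else g) u = u" using u Suc by (auto split: if_splits)
        moreover have "(if even m then f else g) u = ?p m" using n Suc f g by simp
        ultimately show ?thesis using n Suc by metis
      qed
    qed
  qed
  define i where "i = (LEAST n. ?p n = ?p (Suc n))"
  have i: "?p i = ?p (Suc i)" unfolding i_def by (rule LeastI_ex[OF stop])
  have mi: "?p j \<noteq> ?p (Suc j)" if "j < i" for j
    using not_less_Least that unfolding i_def by blast
  have "orb f g v \<subseteq> ?p ` {..i}"
  proof (rule orb_least)
    show "v \<in> ?p ` {..i}" by (rule image_eqI[of _ _ 0]) auto
    fix a assume "a \<in> ?p ` {..i}"
    then obtain n where n: "a = ?p n" "n \<le> i" by auto
    have nx: "(if even n then f else g) a \<in> ?p ` {..i}"
    proof (cases "n = i")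
      case True then show ?thesis using i n by (metis atMost_iff imageI walk.simps(2))
    next
      case False then have "Suc n \<le> i" using n by simp
      then show ?thesis using n by (metis atMost_iff imageI walk.simps(2))
    qed
    have pr: "(if even n then g else f) a \<in> ?p ` {..i}"
    proof (cases n)
      case 0 then show ?thesis using v n by (metis atMost_iff even_zero imageI walk.simps(1))
    next
      case (Suc m)
      then have "(if even n then g else f) a = ?p m" using n f g by simp
      then show ?thesis using Suc n by simp
    qed
    show "f a \<in> ?p ` {..i} \<and> g a \<in> ?p ` {..i}"
      using nx pr by (cases "even n") (auto simp del: walk.simps)
  qed
  \<comment> \<open>Before the first stall, the steps into and out of a vertex other than
    \<open>v\<close> both move, so neither involution fixes it.\<close>
  moreover have "s = ?p i" if s: "s \<in> ?p ` {..i}" "f s = s \<or> g s = s" "s \<noteq> v" for s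
  proof (rule ccontr)
    assume ne: "s \<noteq> ?p i"
    obtain n where n: "s = ?p n" "n \<le> i" using s by auto
    have "n < i" using n ne by (cases "n = i") auto
    obtain m where m: "n = Suc m" using n s by (cases n) auto
    have 1: "(if even n then f else g) s \<noteq> s" using mi[OF \<open>n < i\<close>] n by (metis walk.simps(2))
    have "?p m \<noteq> s" using mi[of m] m \<open>n < i\<close> n by (metis Suc_lessD)
    moreover have "(if even m then f else g) s = ?p m" using n m f g by simp
    ultimately have "(if even m then f else g) s \<noteq> s" by simp
    with 1 s(2) m show False by (auto split: if_splits)
  qed
  ultimately have "u = ?p i" "w = ?p i" using u w by (meson subsetD)+
  then show ?thesis by simp
qed

lemma orb_ends:
  assumes "\<And>v. f (f v) = v" "\<And>v. g (g v) = v" "f v = v \<or> g v = v"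
    and "u \<in> orb f g v" "f u = u \<or> g u = u" "u \<noteq> v"
    and "w \<in> orb f g v" "f w = w \<or> g w = w" "w \<noteq> v"
  shows "u = w"
proof (cases "g v = v")
  case True then show ?thesis using orb_ends_aux[of f g v u w] assms by blast
next
  case False
  then show ?thesis using orb_ends_aux[of g f v u w] assms orb_swap[of f g v] by blast
qed

lemma orb_sym:
  assumes f: "\<And>v. f (f v) = v" and g: "\<And>v. g (g v) = v" and u: "u \<in> orb f g v"
  shows "v \<in> orb f g u"
proof -
  have "orb f g v \<subseteq> {u. v \<in> orb f g u}"
  proof (rule orb_least)
    show "v \<in> {u. v \<in> orb f g u}" by (simp add: orb_refl)
    fix a assume a: "a \<in> {u. v \<in> orb f g u}"
    have "orb f g a \<subseteq> orb f g (f a)"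
      by (rule orb_least) (use orb_closed orb_refl f in metis)+
    moreover have "orb f g a \<subseteq> orb f g (g a)"
      by (rule orb_least) (use orb_closed orb_refl g in metis)+
    ultimately show "f a \<in> {u. v \<in> orb f g u} \<and> g a \<in> {u. v \<in> orb f g u}" using a by auto
  qed
  then show ?thesis using u by auto
qed

subsection \<open>Edge colorings as families of involutions\<close>

text \<open>A proper coloring of \<open>F\<close> is encoded by the map \<open>N\<close> sending a color \<open>c\<close> and a vertex \<open>v\<close> to
  the other end of the edge of color \<open>c\<close> at \<open>v\<close>, and to \<open>v\<close> itself if \<open>c\<close> is missing at \<open>v\<close>.\<close>

definition pcol :: "'a set set \<Rightarrow> nat set \<Rightarrow> (nat \<Rightarrow> 'a \<Rightarrow> 'a) \<Rightarrow> bool" where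
  "pcol F K N \<longleftrightarrow>
     (\<forall>c\<in>K. \<forall>v. N c (N c v) = v) \<and>
     (\<forall>c\<in>K. \<forall>v. N c v \<noteq> v \<longrightarrow> {v, N c v} \<in> F) \<and>
     (\<forall>u v. {u, v} \<in> F \<longrightarrow> u \<noteq> v \<longrightarrow> (\<exists>c\<in>K. N c u = v)) \<and>
     (\<forall>c\<in>K. \<forall>c'\<in>K. \<forall>v. N c v = N c' v \<longrightarrow> N c v \<noteq> v \<longrightarrow> c = c')"

lemma pcolI:
  assumes "\<And>c v. c \<in> K \<Longrightarrow> N c (N c v) = v"
    and "\<And>c v. c \<in> K \<Longrightarrow> N c v \<noteq> v \<Longrightarrow> {v, N c v} \<in> F"
    and "\<And>u v. {u, v} \<in> F \<Longrightarrow> u \<noteq> v \<Longrightarrow> \<exists>c\<in>K. N c u = v"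
    and "\<And>c c' v. c \<in> K \<Longrightarrow> c' \<in> K \<Longrightarrow> N c v = N c' v \<Longrightarrow> N c v \<noteq> v \<Longrightarrow> c = c'"
  shows "pcol F K N"
  unfolding pcol_def by (intro conjI ballI allI impI; (rule assms; assumption))

lemma pcolD:
  assumes "pcol F K N"
  shows "c \<in> K \<Longrightarrow> N c (N c v) = v"
    and "c \<in> K \<Longrightarrow> N c v \<noteq> v \<Longrightarrow> {v, N c v} \<in> F"
    and "{u, v} \<in> F \<Longrightarrow> u \<noteq> v \<Longrightarrow> \<exists>c\<in>K. N c u = v"
    and "c \<in> K \<Longrightarrow> c' \<in> K \<Longrightarrow> N c v = N c' v \<Longrightarrow> N c v \<noteq> v \<Longrightarrow> c = c'"
  using assms unfolding pcol_def by simp_all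

definition tr :: "nat \<Rightarrow> nat \<Rightarrow> nat \<Rightarrow> nat" where
  "tr i j c = (if c = i then j else if c = j then i else c)"

text \<open>This is the Kempe change. \<open>C\<close> is an arbitrary set so that whole chains and
  a single recolored edge are treated alike; properness only asks for closure under
  \<open>N i\<close> and \<open>N j\<close>.\<close>

definition swp :: "nat \<Rightarrow> nat \<Rightarrow> 'a set \<Rightarrow> (nat \<Rightarrow> 'a \<Rightarrow> 'a) \<Rightarrow> nat \<Rightarrow> 'a \<Rightarrow> 'a" where
  "swp i j C N c v = (if v \<in> C then N (tr i j c) v else N c v)"

lemma tr_simps [simp]:
  "tr i j i = j" "tr i j j = i" "c \<noteq> i \<Longrightarrow> c \<noteq> j \<Longrightarrow> tr i j c = c" "tr i j (tr i j c) = c"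
  by (auto simp: tr_def)

lemma tr_inj: "tr i j c = tr i j c' \<Longrightarrow> c = c'"
  by (metis tr_simps(4))

lemma tr_in: "i \<in> K \<Longrightarrow> j \<in> K \<Longrightarrow> c \<in> K \<Longrightarrow> tr i j c \<in> K"
  by (auto simp: tr_def)

lemma swp_out [simp]: "v \<notin> C \<Longrightarrow> swp i j C N c v = N c v"
  and swp_in: "v \<in> C \<Longrightarrow> swp i j C N c v = N (tr i j c) v"
  and swp_other [simp]: "c \<noteq> i \<Longrightarrow> c \<noteq> j \<Longrightarrow> swp i j C N c v = N c v"
  by (auto simp: swp_def)

lemma pcol_swp:
  assumes N: "pcol F K N" and ij: "i \<in> K" "j \<in> K"
    and C: "\<And>v. v \<in> C \<Longrightarrow> N i v \<in> C \<and> N j v \<in> C"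
  shows "pcol F K (swp i j C N)"
proof -
  have C': "N c v \<in> C \<longleftrightarrow> v \<in> C" if "c = i \<or> c = j" for c v
    using C pcolD(1)[OF N] ij that by metis
  have tc: "tr i j c \<noteq> c \<Longrightarrow> tr i j c = i \<or> tr i j c = j" for c by (auto simp: tr_def split: if_splits)
  show ?thesis
  proof (rule pcolI)
    fix c v assume c: "c \<in> K"
    have tK: "tr i j c \<in> K" by (rule tr_in[OF ij c])
    show "swp i j C N c (swp i j C N c v) = v"
    proof (cases "tr i j c = c")
      case True then show ?thesis by (simp add: swp_def pcolD(1)[OF N c])
    next
      case False
      then have "c = i \<or> c = j" by (auto simp: tr_def split: if_splits)
      then have "N c v \<in> C \<longleftrightarrow> v \<in> C" "N (tr i j c) v \<in> C \<longleftrightarrow> v \<in> C" using C' tc[OF False] by blast+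
      then show ?thesis by (simp add: swp_def pcolD(1)[OF N c] pcolD(1)[OF N tK])
    qed
    show "{v, swp i j C N c v} \<in> F" if "swp i j C N c v \<noteq> v"
      using that pcolD(2)[OF N c] pcolD(2)[OF N tK] by (auto simp: swp_def split: if_splits)
  next
    fix u v assume uv: "{u, v} \<in> F" "u \<noteq> v"
    then obtain c where c: "c \<in> K" "N c u = v" using pcolD(3)[OF N] by blast
    show "\<exists>c\<in>K. swp i j C N c u = v"
      by (rule bexI[of _ "if u \<in> C then tr i j c else c"])
         (use c tr_in[OF ij] in \<open>auto simp: swp_def\<close>)
  next
    fix c c' v assume c: "c \<in> K" "c' \<in> K" and eq: "swp i j C N c v = swp i j C N c' v"
      and ne: "swp i j C N c v \<noteq> v"
    show "c = c'"
    proof (cases "v \<in> C")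
      case True
      then have "tr i j c = tr i j c'"
        using eq ne pcolD(4)[OF N, of "tr i j c" "tr i j c'" v] tr_in[OF ij] c by (simp add: swp_def)
      then show ?thesis by (rule tr_inj)
    next
      case False then show ?thesis using eq ne pcolD(4)[OF N] c by (simp add: swp_def)
    qed
  qed
qed

text \<open>The uncolored edge moves from \<open>xy\<close> to \<open>xz\<close> with
  \<open>z = N c x\<close>. The last update is not idle: it sets the value at \<open>z\<close> to
  \<open>z\<close>, which makes \<open>c\<close> missing there.\<close>

definition shf :: "nat \<Rightarrow> 'a \<Rightarrow> 'a \<Rightarrow> (nat \<Rightarrow> 'a \<Rightarrow> 'a) \<Rightarrow> nat \<Rightarrow> 'a \<Rightarrow> 'a" where
  "shf c x y N = N(c := (N c)(x := y, y := x, N c x := N c x))"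

lemma shf_other [simp]: "c' \<noteq> c \<Longrightarrow> shf c x y N c' = N c'"
  and shf_out [simp]: "v \<noteq> x \<Longrightarrow> v \<noteq> y \<Longrightarrow> v \<noteq> N c x \<Longrightarrow> shf c x y N c v = N c v"
  by (auto simp: shf_def)

lemma pcol_shf:
  assumes N: "pcol (E - {{x, y}}) K N" and c: "c \<in> K" and x: "N c x \<noteq> x" and y: "N c y = y"
    and xy: "{x, y} \<in> E" "x \<noteq> y"
  shows "pcol (E - {{x, N c x}}) K (shf c x y N)"
proof -
  define z where "z = N c x"
  have z: "z \<noteq> x" "z \<noteq> y" "N c z = x"
    using x y pcolD(1)[OF N c] unfolding z_def by metis+
  have xzE: "{x, z} \<in> E" using pcolD(2)[OF N c x] by (simp add: z_def)
  have sc: "shf c x y N c v = (if v = x then y else if v = y then x else if v = z then z else N c v)" for v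
    using z by (auto simp: shf_def z_def[symmetric])
  have nb: "N c v \<noteq> x" "N c v \<noteq> y" "N c v \<noteq> z" if "v \<noteq> x" "v \<noteq> y" "v \<noteq> z" for v
    using that z y pcolD(1)[OF N c] by metis+
  have nc: "N c' x \<noteq> y" "N c' y \<noteq> x" if "c' \<in> K" for c'
    using pcolD(2)[OF N that, of x] pcolD(2)[OF N that, of y] xy by (auto simp: insert_commute)
  have nz: "N c' x \<noteq> z" "N c' z \<noteq> x" if "c' \<in> K" "c' \<noteq> c" for c'
    using pcolD(4)[OF N that(1) c, of x] pcolD(4)[OF N that(1) c, of z] that z x z_def by auto
  have "pcol (E - {{x, z}}) K (shf c x y N)"
  proof (rule pcolI)
    fix c' v assume c': "c' \<in> K"
    show "shf c x y N c' (shf c x y N c' v) = v"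
      by (cases "c' = c") (use z nb pcolD(1)[OF N c'] in \<open>auto simp: sc\<close>)
    show "{v, shf c x y N c' v} \<in> E - {{x, z}}" if ne: "shf c x y N c' v \<noteq> v"
    proof (cases "c' = c")
      case True
      then consider "v = x" | "v = y" | "v \<noteq> x" "v \<noteq> y" "v \<noteq> z" using ne by (auto simp: sc split: if_splits)
      then show ?thesis
      proof cases
        case 3
        then show ?thesis using True ne pcolD(2)[OF N c, of v] nb by (auto simp: sc doubleton_eq_iff)
      qed (use True xy z in \<open>auto simp: sc doubleton_eq_iff insert_commute\<close>)
    next
      case False
      then show ?thesis using ne pcolD(2)[OF N c', of v] nz[OF c'] by (auto simp: doubleton_eq_iff)
    qed
  next
    fix u v assume uv: "{u, v} \<in> E - {{x, z}}" "u \<noteq> v"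

    show "\<exists>c'\<in>K. shf c x y N c' u = v"
    proof (cases "{u, v} = {x, y}")
      case True then show ?thesis using c xy by (intro bexI[of _ c]) (auto simp: sc doubleton_eq_iff)
    next
      case False
      then obtain c' where c': "c' \<in> K" "N c' u = v" using uv pcolD(3)[OF N, of u v] by blast
      show ?thesis
      proof (rule bexI[OF _ c'(1)], cases "c' = c")
        case True
        have "u \<noteq> x" "u \<noteq> z" "u \<noteq> y" using True c' uv z y z_def by (auto simp: insert_commute)
        then show "shf c x y N c' u = v" using True c' by (simp add: sc)
      qed (use c' in simp)
    qed
  next
    fix c1 c2 v assume k: "c1 \<in> K" "c2 \<in> K" and eq: "shf c x y N c1 v = shf c x y N c2 v"
      and ne: "shf c x y N c1 v \<noteq> v"
    have key: "False" if d: "c' \<in> K" "c' \<noteq> c" and e: "N c' v = shf c x y N c v" "N c' v \<noteq> v" for c'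
      using pcolD(4)[OF N d(1) c, of v] d e nc[OF d(1)] by (auto simp: sc split: if_splits)
    show "c1 = c2"
      using k eq ne key[of c1] key[of c2] pcolD(4)[OF N k, of v] by (cases "c1 = c"; cases "c2 = c") auto
  qed
  then show ?thesis by (simp add: z_def)
qed

subsection \<open>Critical graphs\<close>

lemma edge_coloring_exists:
  assumes "finite F" shows "\<exists>k c. edge_coloring F k c"
proof -
  obtain f :: "'a set \<Rightarrow> nat" where f: "inj_on f F" using finite_imp_inj_to_nat_seg[OF assms] by blast
  have "edge_coloring F (Suc (Max (insert 0 (f ` F)))) (\<lambda>e. Suc (f e))"
    unfolding edge_coloring_def using f assms by (auto simp: inj_on_def intro!: Max_ge)
  then show ?thesis by blast
qed

lemma chromatic_index_le_iff:
  assumes "finite F" shows "chromatic_index F \<le> k \<longleftrightarrow> (\<exists>c. edge_coloring F k c)"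
proof
  assume le: "chromatic_index F \<le> k"
  have "\<exists>c. edge_coloring F (chromatic_index F) c"
    unfolding chromatic_index_def by (rule LeastI_ex) (rule edge_coloring_exists[OF assms])
  then show "\<exists>c. edge_coloring F k c" using le by (fastforce simp: edge_coloring_def)
next
  assume "\<exists>c. edge_coloring F k c"
  then show "chromatic_index F \<le> k" unfolding chromatic_index_def by (rule Least_le)
qed

lemma pcol_imp_edge_coloring:
  assumes N: "pcol F {1..k} N" and F: "\<And>e. e \<in> F \<Longrightarrow> card e = 2"
  shows "\<exists>c. edge_coloring F k c"
proof -
  define c where "c e = (SOME i. i \<in> {1..k} \<and> (\<exists>u v. e = {u, v} \<and> u \<noteq> v \<and> N i u = v))" for e
  have c: "c e \<in> {1..k} \<and> (\<exists>u v. e = {u, v} \<and> u \<noteq> v \<and> N (c e) u = v)" if e: "e \<in> F" for e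
  proof -
    obtain u v where "e = {u, v}" "u \<noteq> v" using F[OF e] card_2_iff by metis
    then have "\<exists>i. i \<in> {1..k} \<and> (\<exists>u v. e = {u, v} \<and> u \<noteq> v \<and> N i u = v)"
      using pcolD(3)[OF N, of u v] e by blast
    then show ?thesis unfolding c_def by (rule someI_ex)
  qed
  have "e = f" if ef: "e \<in> F" "f \<in> F" "e \<inter> f \<noteq> {}" "c e = c f" for e f
  proof -
    have other: "g = {w, N (c g) w}" if g: "g \<in> F" "w \<in> g" for g w
    proof -
      obtain u v where uv: "g = {u, v}" "u \<noteq> v" "N (c g) u = v" using c[OF g(1)] by blast
      then have "N (c g) v = u" using pcolD(1)[OF N, of "c g" u] c[OF g(1)] by auto
      then show ?thesis using uv g(2) by auto
    qed
    obtain w where "w \<in> e" "w \<in> f" using ef by blast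
    then show ?thesis using other[of e w] other[of f w] ef by simp
  qed
  then have "edge_coloring F k c" unfolding edge_coloring_def using c by blast
  then show ?thesis by blast
qed

lemma edge_coloring_imp_pcol:
  assumes c: "edge_coloring F k c"
  shows "\<exists>N. pcol F {1..k} N"
proof -
  define P where "P i v u \<longleftrightarrow> {v, u} \<in> F \<and> v \<noteq> u \<and> c {v, u} = i" for i v u
  define N where "N i v = (if \<exists>u. P i v u then SOME u. P i v u else v)" for i v
  have uniq: "u = u'" if "P i v u" "P i v u'" for i v u u'
  proof -
    have "{v, u} = {v, u'}"
      using that c insertI1 unfolding P_def edge_coloring_def by (metis disjoint_iff)
    then show ?thesis using that by (auto simp: doubleton_eq_iff P_def)
  qed
  have N_eq: "N i v = u" if "P i v u" for i v u
  proof -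
    have "P i v (SOME u. P i v u)" using that by (rule someI)
    then show ?thesis using that uniq unfolding N_def by auto
  qed
  have sym: "P i v u \<Longrightarrow> P i u v" for i v u by (auto simp: P_def insert_commute)
  have N_P: "P i v (N i v)" if ne: "N i v \<noteq> v" for i v
  proof -
    obtain u where "P i v u" using ne unfolding N_def by metis
    then show ?thesis using N_eq by metis
  qed
  have "pcol F {1..k} N"
  proof (rule pcolI)
    show "N i (N i v) = v" for i v
    proof (cases "N i v = v")
      case False show ?thesis by (rule N_eq[OF sym[OF N_P[OF False]]])
    qed simp
    show "N i v \<noteq> v \<Longrightarrow> {v, N i v} \<in> F" for i v using N_P[of i v] by (simp add: P_def)
    show "\<exists>i\<in>{1..k}. N i u = v" if "{u, v} \<in> F" "u \<noteq> v" for u v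
      using that N_eq[of "c {u, v}" u v] c by (auto simp: P_def edge_coloring_def)
    show "i = j" if "N i v = N j v" "N i v \<noteq> v" for i j v
      using N_P[of i v] N_P[of j v] that by (simp add: P_def)
  qed
  then show ?thesis by blast
qed

locale critical_graph =
  fixes V :: "'a set" and E :: "'a set set" and \<Delta> :: nat
  assumes critical: "edge_critical \<Delta> V E"
begin

definition K :: "nat set" where "K = {1..\<Delta>}"

lemma fin_K: "finite K" and card_K: "card K = \<Delta>"
  by (simp_all add: K_def)

definition nb :: "'a \<Rightarrow> 'a set" where "nb v = {u. {v, u} \<in> E}"

definition dg :: "'a \<Rightarrow> nat" where "dg v = card (nb v)"

lemma finV: "finite V" and E_sub: "e \<in> E \<Longrightarrow> e \<subseteq> V" and E_card: "e \<in> E \<Longrightarrow> card e = 2"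
  using critical by (auto simp: edge_critical_def simple_graph_def)

lemma finE: "finite E"
  using finV E_sub by (intro finite_subset[of E "Pow V"]) auto

lemma edge_neq: "{u, v} \<in> E \<Longrightarrow> u \<noteq> v"
  using E_card by fastforce

lemma nb_V: "nb v \<subseteq> V" and nb_V': "nb v \<noteq> {} \<Longrightarrow> v \<in> V"
  using E_sub by (auto simp: nb_def)

lemma nb_sym: "u \<in> nb v \<longleftrightarrow> v \<in> nb u"
  by (simp add: nb_def insert_commute)

lemma nb_irrefl: "v \<notin> nb v"
  using edge_neq[of v v] by (auto simp: nb_def)

lemma fin_nb: "finite (nb v)"
  using nb_V finV finite_subset by metis

lemma vertex_degree_dg: "vertex_degree E v = dg v"
proof -
  have "{e \<in> E. v \<in> e} = (\<lambda>u. {v, u}) ` nb v"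
  proof (intro equalityI subsetI)
    fix e assume e: "e \<in> {e \<in> E. v \<in> e}"
    then obtain a b where "e = {a, b}" using E_card card_2_iff by (metis mem_Collect_eq)
    then have "e = {v, if v = a then b else a}" using e by auto
    then show "e \<in> (\<lambda>u. {v, u}) ` nb v" using e by (auto simp: nb_def)
  qed (auto simp: nb_def)
  moreover have "inj_on (\<lambda>u. {v, u}) (nb v)" by (auto simp: inj_on_def doubleton_eq_iff)
  ultimately show ?thesis by (simp add: vertex_degree_def dg_def card_image)
qed

lemma dg_le: "dg v \<le> \<Delta>"
proof (cases "v \<in> V")
  case True
  then have "dg v \<le> max_degree V E"
    unfolding max_degree_def using finV by (intro Max_ge) (auto simp: vertex_degree_dg)
  then show ?thesis using critical by (simp add: edge_critical_def)
next
  case False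
  then have "nb v = {}" using nb_V' by blast
  then show ?thesis by (simp add: dg_def)
qed

lemma not_pcol: "\<not> pcol E K N"
proof
  assume "pcol E K N"
  then have "chromatic_index E \<le> \<Delta>"
    using pcol_imp_edge_coloring[of E \<Delta> N] E_card chromatic_index_le_iff[OF finE] unfolding K_def by blast
  then show False using critical by (simp add: edge_critical_def)
qed

definition col :: "'a \<Rightarrow> 'a \<Rightarrow> (nat \<Rightarrow> 'a \<Rightarrow> 'a) \<Rightarrow> bool" where
  "col x y N \<longleftrightarrow> {x, y} \<in> E \<and> pcol (E - {{x, y}}) K N"

lemma col_exists:
  assumes "{x, y} \<in> E" shows "\<exists>N. col x y N"
proof -
  have "proper_subgraph V (E - {{x, y}}) V E"
    using finV E_sub E_card assms by (simp add: proper_subgraph_def simple_graph_def) blast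
  then have "chromatic_index (E - {{x, y}}) \<le> \<Delta>" using critical by (simp add: edge_critical_def)
  then have "\<exists>c. edge_coloring (E - {{x, y}}) \<Delta> c"
    using chromatic_index_le_iff[of "E - {{x, y}}"] finE by simp
  then show ?thesis using edge_coloring_imp_pcol assms unfolding col_def K_def by blast
qed

lemma
  assumes "col x y N"
  shows col_inv: "c \<in> K \<Longrightarrow> N c (N c v) = v"
    and col_edge: "c \<in> K \<Longrightarrow> N c v \<noteq> v \<Longrightarrow> {v, N c v} \<in> E"
    and col_edge': "c \<in> K \<Longrightarrow> N c v \<noteq> v \<Longrightarrow> {v, N c v} \<noteq> {x, y}"
    and col_ex: "{u, v} \<in> E \<Longrightarrow> {u, v} \<noteq> {x, y} \<Longrightarrow> \<exists>c\<in>K. N c u = v"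
    and col_inj: "c \<in> K \<Longrightarrow> c' \<in> K \<Longrightarrow> N c v = N c' v \<Longrightarrow> N c v \<noteq> v \<Longrightarrow> c = c'"
proof -
  have N: "pcol (E - {{x, y}}) K N" using assms by (simp add: col_def)
  show "c \<in> K \<Longrightarrow> N c (N c v) = v" by (rule pcolD(1)[OF N])
  show "c \<in> K \<Longrightarrow> N c v \<noteq> v \<Longrightarrow> {v, N c v} \<in> E"
    "c \<in> K \<Longrightarrow> N c v \<noteq> v \<Longrightarrow> {v, N c v} \<noteq> {x, y}" using pcolD(2)[OF N, of c v] by simp_all
  show "{u, v} \<in> E \<Longrightarrow> {u, v} \<noteq> {x, y} \<Longrightarrow> \<exists>c\<in>K. N c u = v"
    using pcolD(3)[OF N, of u v] edge_neq[of u v] by simp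
  show "c \<in> K \<Longrightarrow> c' \<in> K \<Longrightarrow> N c v = N c' v \<Longrightarrow> N c v \<noteq> v \<Longrightarrow> c = c'" by (rule pcolD(4)[OF N])
qed

lemma col_neq: "col x y N \<Longrightarrow> x \<noteq> y"
  using edge_neq by (auto simp: col_def)

lemma col_sym: "col x y N \<Longrightarrow> col y x N"
  by (simp add: col_def insert_commute)

lemma col_xy: "col x y N \<Longrightarrow> c \<in> K \<Longrightarrow> N c x \<noteq> y" "col x y N \<Longrightarrow> c \<in> K \<Longrightarrow> N c y \<noteq> x"
  using col_edge'[of x y N c x] col_edge'[of x y N c y] col_neq[of x y N]
  by (auto simp: insert_commute)

lemma col_back: "col x y N \<Longrightarrow> c \<in> K \<Longrightarrow> N c u = v \<Longrightarrow> N c v = u"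
  using col_inv by blast

lemma col_swp:
  assumes "col x y N" "i \<in> K" "j \<in> K" "\<And>v. v \<in> C \<Longrightarrow> N i v \<in> C \<and> N j v \<in> C"
  shows "col x y (swp i j C N)"
  using assms pcol_swp[of "E - {{x, y}}" K N i j C] by (simp add: col_def)

lemma col_shf:
  assumes "col x y N" "c \<in> K" "N c x = z" "z \<noteq> x" "N c y = y"
  shows "col x z (shf c x y N)"
  using assms pcol_shf[of E x y K N c] col_neq[OF assms(1)] pcolD(2)[of "E - {{x, y}}" K N c x]
  by (auto simp: col_def)

lemma shf_at:
  assumes "col x y N" "c \<in> K" "N c x = z" "z \<noteq> x" "N c y = y"
  shows "shf c x y N c x = y" "shf c x y N c y = x" "shf c x y N c z = z" "z \<noteq> y"
proof -
  show "z \<noteq> y" using col_xy(1)[OF assms(1,2)] assms(3) by auto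
  then show "shf c x y N c x = y" "shf c x y N c y = x" "shf c x y N c z = z"
    using assms col_neq[OF assms(1)] by (auto simp: shf_def)
qed

lemma col_recolor:
  assumes "col x y N" "i \<in> K" "j \<in> K" "N i u = v" "N j u = u" "N j v = v"
  shows "col x y (swp i j {u, v} N)"
  using assms col_back[OF assms(1,2,4)] by (intro col_swp) auto

text \<open>A color missing at both ends could be given to \<open>xy\<close>, against criticality.
  The arguments by Kempe changes all end in this contradiction, directly or through a lemma derived
  from it.\<close>

lemma col_disj:
  assumes N: "col x y N" and c: "c \<in> K" and x: "N c x = x"
  shows "N c y \<noteq> y"
proof
  assume y: "N c y = y"
  have xy: "{x, y} \<in> E" "x \<noteq> y" using N col_neq by (auto simp: col_def)
  define M where "M = N(c := (N c)(x := y, y := x))"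
  have Mc: "M c v = (if v = x then y else if v = y then x else N c v)" for v by (simp add: M_def)
  have Mo: "M c' = N c'" if "c' \<noteq> c" for c' using that by (simp add: M_def)
  have nb: "N c v \<noteq> x" "N c v \<noteq> y" if "v \<noteq> x" "v \<noteq> y" for v
    using col_back[OF N c, of v x] col_back[OF N c, of v y] that x y by auto
  have "pcol E K M"
  proof (rule pcolI)
    fix c' v assume c': "c' \<in> K"
    show "M c' (M c' v) = v"
      by (cases "c' = c") (use nb col_inv[OF N c'] in \<open>auto simp: Mc Mo\<close>)
    show "{v, M c' v} \<in> E" if "M c' v \<noteq> v"
      using that col_edge[OF N c', of v] xy by (cases "c' = c") (auto simp: Mc Mo insert_commute split: if_splits)
  next
    fix u v assume uv: "{u, v} \<in> E" "u \<noteq> v"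
    show "\<exists>c\<in>K. M c u = v"
    proof (cases "{u, v} = {x, y}")
      case True then show ?thesis using c xy by (intro bexI[of _ c]) (auto simp: Mc doubleton_eq_iff)
    next
      case False
      then obtain c' where c': "c' \<in> K" "N c' u = v" using col_ex[OF N uv(1)] by blast
      then have "M c' u = v" using uv x y by (cases "c' = c") (auto simp: Mc Mo)
      then show ?thesis using c' by blast
    qed
  next
    fix c1 c2 v assume k: "c1 \<in> K" "c2 \<in> K" and eq: "M c1 v = M c2 v" and ne: "M c1 v \<noteq> v"
    have key: False if d: "c' \<in> K" "c' \<noteq> c" "N c' v = M c v" "N c' v \<noteq> v" for c'
      using col_inj[OF N d(1) c, of v] d col_xy[OF N d(1)] by (auto simp: Mc split: if_splits)
    show "c1 = c2"
      using k eq ne key[of c1] key[of c2] col_inj[OF N k, of v] by (cases "c1 = c"; cases "c2 = c") (auto simp: Mo)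
  qed
  then show False using not_pcol by blast
qed

definition Ms :: "(nat \<Rightarrow> 'a \<Rightarrow> 'a) \<Rightarrow> 'a \<Rightarrow> nat set" where
  "Ms N v = {c \<in> K. N c v = v}"

lemma Ms_K: "Ms N v \<subseteq> K" and fin_Ms: "finite (Ms N v)"
  by (auto simp: Ms_def fin_K)

lemma card_Ms_aux:
  assumes N: "col x y N"
  shows "card (Ms N v) + card (nb v - {u. {v, u} = {x, y}}) = \<Delta>"
proof -
  have "bij_betw (\<lambda>c. N c v) (K - Ms N v) (nb v - {u. {v, u} = {x, y}})"
    unfolding bij_betw_def
  proof (intro conjI equalityI subsetI)
    show "inj_on (\<lambda>c. N c v) (K - Ms N v)"
      using col_inj[OF N] by (auto simp: inj_on_def Ms_def)
    show "u \<in> nb v - {u. {v, u} = {x, y}}" if u: "u \<in> (\<lambda>c. N c v) ` (K - Ms N v)" for u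
    proof -
      obtain c where "c \<in> K" "N c v \<noteq> v" "u = N c v" using u by (auto simp: Ms_def)
      then show ?thesis using col_edge[OF N, of c v] col_edge'[OF N, of c v] by (simp add: nb_def)
    qed
    show "u \<in> (\<lambda>c. N c v) ` (K - Ms N v)" if u: "u \<in> nb v - {u. {v, u} = {x, y}}" for u
    proof -
      have "{v, u} \<in> E" "{v, u} \<noteq> {x, y}" using u by (auto simp: nb_def)
      then obtain c where "c \<in> K" "N c v = u" "u \<noteq> v" using col_ex[OF N] edge_neq by metis
      then show ?thesis by (auto simp: Ms_def)
    qed
  qed
  then have "card (K - Ms N v) = card (nb v - {u. {v, u} = {x, y}})" by (rule bij_betw_same_card)
  moreover have "card (K - Ms N v) + card (Ms N v) = \<Delta>"
    using card_Diff_subset[of "Ms N v" K] card_mono[of K "Ms N v"] fin_Ms[of N v] Ms_K[of N v] fin_K card_K by simp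
  ultimately show ?thesis by simp
qed

lemma card_Ms_other:
  assumes N: "col x y N" and "v \<noteq> x" "v \<noteq> y"
  shows "card (Ms N v) + dg v = \<Delta>"
proof -
  have "nb v - {u. {v, u} = {x, y}} = nb v" using assms by (auto simp: doubleton_eq_iff)
  then show ?thesis using card_Ms_aux[OF N, of v] by (simp add: dg_def)
qed

text \<open>The uncolored edge counts in \<open>dg x\<close> but uses no color; this is the extra 1
  that reappears in later counts.\<close>

lemma card_Ms_x:
  assumes N: "col x y N" shows "card (Ms N x) + dg x = \<Delta> + 1"
proof -
  have "nb x - {u. {x, u} = {x, y}} = nb x - {y}" using col_neq[OF N] by (auto simp: doubleton_eq_iff)
  moreover have "y \<in> nb x" using N by (simp add: col_def nb_def)
  moreover have "dg x > 0" using calculation fin_nb by (auto simp: dg_def card_gt_0_iff)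
  ultimately show ?thesis using card_Ms_aux[OF N, of x] fin_nb[of x]
    by (simp add: dg_def)
qed

lemma card_Ms_y: "col x y N \<Longrightarrow> card (Ms N y) + dg y = \<Delta> + 1"
  using card_Ms_x[OF col_sym] .

lemma ex_missing: "col x y N \<Longrightarrow> \<exists>b\<in>K. N b y = y"
proof -
  assume N: "col x y N"
  have "card (Ms N y) > 0" using card_Ms_y[OF N] dg_le[of y] by linarith
  then show ?thesis by (auto simp: card_gt_0_iff Ms_def)
qed

lemma Ms_disj: "col x y N \<Longrightarrow> Ms N x \<inter> Ms N y = {}"
  using col_disj by (auto simp: Ms_def)

subsection \<open>Kempe changes\<close>

lemma orb_ends':
  assumes N: "col x y N" and K: "i \<in> K" "j \<in> K"
    and "N i a = a \<or> N j a = a" "N i b = b \<or> N j b = b" "N i c = c \<or> N j c = c"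
    and "a \<noteq> b" "b \<noteq> c" "a \<noteq> c" "b \<in> orb (N i) (N j) a"
  shows "c \<notin> orb (N i) (N j) a"
  using orb_ends[of "N i" "N j" a b c] col_inv[OF N] assms by blast

lemma col_swp_orb:
  assumes "col x y N" "i \<in> K" "j \<in> K"
  shows "col x y (swp i j (orb (N i) (N j) v) N)"
  by (rule col_swp[OF assms]) (simp add: orb_closed)

lemma orb_back:
  assumes N: "col x y N" and ij: "i \<in> K" "j \<in> K" and u: "c = i \<or> c = j" "N c u = v"
  shows "v \<in> orb (N i) (N j) a \<longleftrightarrow> u \<in> orb (N i) (N j) a"
  using orb_closed[of u "N i" "N j" a] orb_closed[of v "N i" "N j" a] u col_back[OF N, of c u v] ij by auto

text \<open>Otherwise swapping along the chain of \<open>x\<close> would make \<open>b\<close>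
  missing at both ends of the uncolored edge.\<close>

lemma link:
  assumes N: "col x y N" and K: "b \<in> K" "g \<in> K" and x: "N g x = x" and y: "N b y = y"
  shows "y \<in> orb (N b) (N g) x"
proof (rule ccontr)
  let ?C = "orb (N b) (N g) x"
  assume "y \<notin> ?C"
  then have "swp b g ?C N b y = y" "swp b g ?C N b x = x"
    using x y by (auto simp: swp_in orb_refl)
  then show False using col_disj[OF col_swp_orb[OF N K, of x] K(1)] by blast
qed

text \<open>By \<open>link\<close> one chain has \<open>x\<close> and \<open>y\<close> as its two
  ends, so the chain of a third end \<open>w\<close> avoids both. Swapping along it trades
  \<open>b\<close> and \<open>g\<close> at \<open>w\<close> while all colors at \<open>x\<close> and
  \<open>y\<close> stay, which is the basic move of what follows.\<close>

lemma free_chain: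
  assumes N: "col x y N" and K: "b \<in> K" "g \<in> K" and x: "N g x = x" and y: "N b y = y"
    and w: "w \<noteq> x" "w \<noteq> y" "N b w = w \<or> N g w = w"
  shows "x \<notin> orb (N b) (N g) w" "y \<notin> orb (N b) (N g) w"
proof -
  have l: "y \<in> orb (N b) (N g) x" by (rule link[OF N K x y])
  have "w \<notin> orb (N b) (N g) x"
    by (rule orb_ends'[OF N K _ _ _ _ _ _ l]) (use w x y col_neq[OF N] in auto)
  moreover have l': "x \<in> orb (N b) (N g) y"
    using orb_sym[OF _ _ l] col_inv[OF N] K by blast
  moreover have "w \<notin> orb (N b) (N g) y"
    by (rule orb_ends'[OF N K _ _ _ _ _ _ l']) (use w x y col_neq[OF N] in auto)
  ultimately show "x \<notin> orb (N b) (N g) w" "y \<notin> orb (N b) (N g) w"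
    using orb_sym[of "N b" "N g"] col_inv[OF N] K by blast+
qed

subsection \<open>Vizing fans\<close>

text \<open>Recoloring \<open>yv\<close> from \<open>c\<close> to \<open>b\<close> would make
  \<open>c\<close> missing at both ends of \<open>xy\<close>.\<close>

lemma fan_y:
  assumes N: "col x y N" and c: "c \<in> K" "N c x = x" "N c y = v" "v \<noteq> y" and b: "b \<in> K" "N b y = y"
  shows "N b v \<noteq> v"
proof
  assume v: "N b v = v"
  have vx: "v \<noteq> x" using col_xy(2)[OF N c(1)] c by blast
  have M: "col x y (swp c b {y, v} N)" by (rule col_recolor[OF N c(1) b(1) c(3) b(2) v])
  have "swp c b {y, v} N c x = x" "swp c b {y, v} N c y = y"
    using c b vx col_neq[OF N] by (auto simp: swp_def)
  then show False using col_disj[OF M c(1)] by blast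
qed

lemma fan_x:
  assumes N: "col x y N" and c: "c \<in> K" "N c x = x" "N c y = v" "v \<noteq> y" and g: "g \<in> K" "N g x = x"
  shows "N g v \<noteq> v"
proof
  assume v: "N g v = v"
  obtain b where b: "b \<in> K" "N b y = y" using ex_missing[OF N] by blast
  have vx: "v \<noteq> x" using col_xy(2)[OF N c(1)] c by blast
  have cg: "c \<noteq> g" using col_back[OF N c(1,3)] v c(4) by auto
  have cb: "c \<noteq> b" using b c by auto
  let ?C = "orb (N b) (N g) v"
  let ?M = "swp b g ?C N"
  note out = free_chain[OF N b(1) g(1) g(2) b(2) vx c(4), OF disjI2, OF v]
  have M: "col x y ?M" by (rule col_swp_orb[OF N b(1) g(1)])
  have "?M c x = x" "?M c y = v" "?M b y = y" using c b out cg cb by auto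
  moreover have "?M b v = v" by (simp add: swp_in orb_refl v)
  ultimately show False using fan_y[OF M c(1) _ _ c(4) b(1)] by blast
qed

text \<open>The chain of \<open>y\<close> in the colors \<open>b\<close> and \<open>g\<close> has
  only one other end, so it avoids \<open>v\<close> or \<open>v'\<close>. A swap at the avoided one
  makes \<open>b\<close> missing there, against \<open>fan_y\<close>.\<close>

lemma fan_pair:
  assumes N: "col x y N" and c: "c \<in> K" "N c x = x" "N c y = v" "v \<noteq> y"
    and c': "c' \<in> K" "N c' x = x" "N c' y = v'" "v' \<noteq> y" and ne: "v \<noteq> v'"
    and g: "g \<in> K" "N g v = v"
  shows "N g v' \<noteq> v'"
proof
  assume v': "N g v' = v'"
  obtain b where b: "b \<in> K" "N b y = y" using ex_missing[OF N] by blast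
  have gc: "g \<noteq> c" using col_back[OF N c(1,3)] g c(4) by auto
  have gc': "g \<noteq> c'" using col_back[OF N c'(1,3)] v' c'(4) by auto
  have bc: "b \<noteq> c" "b \<noteq> c'" using b c c' by auto
  have key: False if d: "d \<in> K" "N d x = x" "N d y = u" "u \<noteq> y" "N g u = u" "d \<noteq> g" "d \<noteq> b"
    and u: "u \<notin> orb (N b) (N g) y" for d u
  proof -
    let ?C = "orb (N b) (N g) u"
    let ?M = "swp b g ?C N"
    have M: "col x y ?M" by (rule col_swp_orb[OF N b(1) g(1)])
    have "y \<notin> ?C" using u orb_sym[of "N b" "N g" y u] col_inv[OF N] b g by blast
    then have "?M d x = x" "?M d y = u" "?M b y = y" using d b by auto
    moreover have "?M b u = u" by (simp add: swp_in orb_refl d)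
    ultimately show False using fan_y[OF M d(1) _ _ d(4) b(1)] by blast
  qed
  have "v \<notin> orb (N b) (N g) y \<or> v' \<notin> orb (N b) (N g) y"
    using orb_ends'[OF N b(1) g(1), of y v v'] b g v' c c' ne by auto
  then show False using key[OF c(1-4) g(2)] key[OF c' v'] gc gc' bc by auto
qed

subsection \<open>Kierstead paths\<close>

text \<open>For a path \<open>xyzw\<close> in which the color of \<open>zw\<close> is missing at \<open>x\<close> or \<open>y\<close>, two colors that are missing
  at \<open>w\<close> and also at \<open>x\<close> or \<open>y\<close> can be traded by Kempe changes for the color \<open>a0\<close> of \<open>yz\<close> and a color
  \<open>b\<close> missing at \<open>y\<close>. In that situation one moves the uncolored edge to \<open>yz\<close> and uses \<open>zw\<close> to store \<open>a0\<close>
  while \<open>xy\<close> is recolored with \<open>b\<close>.\<close>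

lemma kierstead_core:
  assumes N: "col x y N" and a0: "a0 \<in> K" "N a0 x = x" "N a0 y = z" "z \<noteq> y"
    and a: "a \<in> K" "N a x = x" "a \<noteq> a0" "N a z = w"
    and w: "w \<noteq> z" "w \<noteq> x" "w \<noteq> y" "N a0 w = w" "N b w = w"
    and b: "b \<in> K" "N b y = y"
  shows False
proof -
  have xy: "x \<noteq> y" by (rule col_neq[OF N])
  have zx: "z \<noteq> x" using col_xy(2)[OF N, OF a0(1)] a0(3) by blast
  have ba: "b \<noteq> a" using col_disj[OF N, OF a(1,2)] b by auto
  have ba0: "b \<noteq> a0" using b a0 by auto
  have aw: "N a w = z" by (rule col_back[OF N, OF a(1,4)])
  let ?N1 = "shf a0 y x N"
  have N1: "col y z ?N1" by (rule col_shf[OF col_sym[OF N], OF a0(1,3,4,2)])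
  note s1 = shf_at[OF col_sym[OF N], OF a0(1,3,4,2)]
  have w1: "?N1 a0 w = w" using w a0 by simp
  let ?N2 = "swp a a0 {z, w} ?N1"
  have N2: "col y z ?N2" by (rule col_recolor[OF N1, OF a(1) a0(1)]) (use a s1 w1 in auto)
  have v2: "?N2 a z = z" "?N2 a w = w" "?N2 a x = x" "?N2 b y = y" "?N2 b w = w"
    "?N2 a0 x = y" "?N2 a0 y = x" "?N2 a0 z = w" "?N2 a0 w = z" "?N2 b x = N b x"
    using a a0 w1 w b ba ba0 s1 zx aw xy by (auto simp: swp_def)
  \<comment> \<open>Now \<open>yz\<close> is uncolored with \<open>b\<close> missing at
    \<open>y\<close> and \<open>a\<close> at \<open>z\<close>, so these two are the ends of one
    chain, while \<open>w\<close> misses both colors and is a chain by itself. Hence the swap at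
    \<open>x\<close> disturbs none of them.\<close>
  let ?C = "orb (?N2 b) (?N2 a) x"
  have out: "z \<notin> ?C" "y \<notin> ?C"
    using free_chain[OF col_sym[OF N2], OF b(1) a(1) v2(1,4), of x] zx xy v2(3) by auto
  have "w \<notin> ?C"
  proof
    assume "w \<in> ?C"
    then have "x \<in> orb (?N2 b) (?N2 a) w"
      using orb_sym[of "?N2 b" "?N2 a" w x] col_inv[OF N2] a b by blast
    moreover have "orb (?N2 b) (?N2 a) w \<subseteq> {w}" by (rule orb_least) (use v2 in auto)
    ultimately show False using w by auto
  qed
  note out = out this
  let ?N3 = "swp b a ?C ?N2"
  have N3: "col y z ?N3" by (rule col_swp_orb[OF N2, OF b(1) a(1)])
  have v3: "?N3 b x = x" "?N3 b y = y" "?N3 a z = z" "?N3 a w = w"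
    "?N3 a0 x = y" "?N3 a0 y = x" "?N3 a0 z = w" "?N3 a0 w = z"
    using v2 out ba ba0 a(3) by (auto simp: swp_in orb_refl)
  let ?N4 = "swp a0 b {x, y} ?N3"
  have N4: "col y z ?N4" by (rule col_recolor[OF N3, OF a0(1) b(1) v3(5,1,2)])
  have v4: "?N4 a0 y = y" "?N4 a z = z" "?N4 a w = w" "?N4 a0 z = w" "?N4 a0 w = z"
    using v3 w zx a0(4) by (auto simp: swp_def)
  let ?N5 = "swp a0 a {z, w} ?N4"
  have N5: "col y z ?N5" by (rule col_recolor[OF N4, OF a0(1) a(1) v4(4,2,3)])
  have "?N5 a0 y = y" "?N5 a0 z = z" using v4 w a0(4) by (auto simp: swp_def)
  then show False using col_disj[OF N5, OF a0(1)] by blast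
qed

text \<open>The core case needs \<open>a0\<close> missing at \<open>w\<close>. With the uncolored
  edge moved to \<open>yz\<close>, \<open>a0\<close> is missing at \<open>z\<close> and
  \<open>b\<close> at \<open>y\<close>, so a free chain trades \<open>b\<close> for
  \<open>a0\<close> at \<open>w\<close>. Then the uncolored edge moves back, and \<open>d\<close>
  supplies the second color at \<open>w\<close>.\<close>

lemma kierstead_near:
  assumes N: "col x y N" and a0: "a0 \<in> K" "N a0 x = x" "N a0 y = z" "z \<noteq> y"
    and a: "a \<in> K" "N a x = x" "a \<noteq> a0" "N a z = w"
    and w: "w \<noteq> z" "w \<noteq> x" "w \<noteq> y"
    and b: "b \<in> K" "N b y = y" "N b w = w"
    and d: "d \<in> K" "N d x = x \<or> N d y = y" "N d w = w" "d \<noteq> b"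
  shows False
proof (cases "d = a0")
  case True then show False using kierstead_core[OF N, OF a0 a w _ b(3,1,2)] d by blast
next
  case False
  have xy: "x \<noteq> y" by (rule col_neq[OF N])
  have zx: "z \<noteq> x" using col_xy(2)[OF N, OF a0(1)] a0(3) by blast
  have ba: "b \<noteq> a" using col_disj[OF N, OF a(1,2)] b by auto
  have ba0: "b \<noteq> a0" using b a0 by auto
  have aw: "N a w = z" by (rule col_back[OF N, OF a(1,4)])
  have da: "d \<noteq> a" using aw d w by auto
  let ?N1 = "shf a0 y x N"
  have N1: "col y z ?N1" by (rule col_shf[OF col_sym[OF N], OF a0(1,3,4,2)])
  note s1 = shf_at[OF col_sym[OF N], OF a0(1,3,4,2)]
  have b1: "?N1 b = N b" using ba0 by simp
  let ?C = "orb (?N1 b) (?N1 a0) w"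
  have out: "z \<notin> ?C" "y \<notin> ?C"
    using free_chain[OF col_sym[OF N1], OF b(1) a0(1) s1(3), of w] b b1 w by auto
  then have "x \<notin> ?C" using orb_back[OF N1, OF b(1) a0(1), of a0 y x] s1 by blast
  note out = out this
  let ?N2 = "swp b a0 ?C ?N1"
  have N2: "col y z ?N2" by (rule col_swp_orb[OF N1, OF b(1) a0(1)])
  have v2: "?N2 a0 x = y" "?N2 a0 y = x" "?N2 a0 z = z" "?N2 a0 w = w"
    using out s1 b b1 by (auto simp: swp_in orb_refl)
  have o2: "?N2 c v = N c v" if "c \<noteq> b" "c \<noteq> a0" for c v using that by simp
  let ?M = "shf a0 y z ?N2"
  have M: "col x y ?M" by (rule col_sym[OF col_shf[OF N2, OF a0(1) v2(2) xy v2(3)]])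
  note s2 = shf_at[OF N2, OF a0(1) v2(2) xy v2(3)]
  have oM: "?M c v = N c v" if "c \<noteq> b" "c \<noteq> a0" for c v using that by simp
  have vM: "?M a0 x = x" "?M a0 y = z" "?M a x = x" "?M a z = w" "?M a0 w = w" "?M b y = y" "?M d w = w"
    using s2 oM[of a] oM[of d] a ba da v2 w d False ba0 out b1 b by auto
  have dM: "?M d x = x \<or> ?M d y = y" using oM[of d] d False by simp
  show False
  proof (cases "?M d y = y")
    case True
    then show False
      using kierstead_core[OF M, OF a0(1) vM(1,2) a0(4) a(1) vM(3) a(3) vM(4) w vM(5,7) d(1)] by blast
  next
    case False
    then have dx: "?M d x = x" using dM by blast
    let ?D = "orb (?M b) (?M d) w"
    have outD: "x \<notin> ?D" "y \<notin> ?D"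
      using free_chain[OF M, OF b(1) d(1) dx vM(6) w(2,3)] vM(7) by blast+
    let ?P = "swp b d ?D ?M"
    have P: "col x y ?P" by (rule col_swp_orb[OF M, OF b(1) d(1)])
    have "?P a0 x = x" "?P a0 y = z" "?P a x = x" "?P a z = w" "?P a0 w = w" "?P b w = w" "?P b y = y"
      using vM outD \<open>d \<noteq> a0\<close> ba0 ba da by (auto simp: swp_in orb_refl)
    then show False using kierstead_core[OF P, OF a0(1) _ _ a0(4) a(1) _ a(3) _ w _ _ b(1)] by blast
  qed
qed

text \<open>If both colors are missing only at \<open>x\<close>, one that differs from
  \<open>a0\<close> is traded at \<open>w\<close> for a color missing at \<open>y\<close>, which
  leads back to \<open>kierstead_near\<close>.\<close>

lemma kierstead_x:
  assumes N: "col x y N" and a0: "a0 \<in> K" "N a0 x = x" "N a0 y = z" "z \<noteq> y"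
    and a: "a \<in> K" "N a x = x" "a \<noteq> a0" "N a z = w"
    and w: "w \<noteq> z" "w \<noteq> x" "w \<noteq> y"
    and d: "d \<in> K" "N d x = x \<or> N d y = y" "N d w = w"
    and e: "e \<in> K" "N e x = x \<or> N e y = y" "N e w = w" "d \<noteq> e"
  shows False
proof -
  have main: False if d: "d \<in> K" "N d x = x" "N d w = w" "d \<noteq> a0"
    and e: "e \<in> K" "N e x = x" "N e w = w" "d \<noteq> e" for d e
  proof -
    obtain b where b: "b \<in> K" "N b y = y" using ex_missing[OF N] by blast
    have ba: "b \<noteq> a" using col_disj[OF N, OF a(1,2)] b by auto
    have ba0: "b \<noteq> a0" using b a0 by auto
    have be: "b \<noteq> e" using col_disj[OF N, OF e(1,2)] b by auto
    have da: "d \<noteq> a" using col_back[OF N, OF a(1,4)] d w by auto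
    let ?C = "orb (N b) (N d) w"
    have out: "x \<notin> ?C" "y \<notin> ?C" using free_chain[OF N, OF b(1) d(1,2) b(2) w(2,3)] d(3) by blast+
    let ?M = "swp b d ?C N"
    have M: "col x y ?M" by (rule col_swp_orb[OF N, OF b(1) d(1)])
    have v: "?M a0 x = x" "?M a0 y = z" "?M a x = x" "?M a z = w" "?M b y = y" "?M b w = w"
      "?M e x = x" "?M e w = w"
      using out a0 a b d e ba ba0 be da by (auto simp: swp_in orb_refl)
    show False
      by (rule kierstead_near[OF M, OF a0(1) v(1,2) a0(4) a(1) v(3) a(3) v(4) w b(1) v(5,6) e(1) _ v(8)])
         (use v be in auto)
  qed
  show False
  proof (cases "N d y = y \<or> N e y = y")
    case True
    then show False
      using kierstead_near[OF N, OF a0 a w d(1) _ d(3) e(1,2,3)]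
        kierstead_near[OF N, OF a0 a w e(1) _ e(3) d(1,2,3)] e(4) by blast
  next
    case False
    then show False using main[of d e] main[of e d] d e by blast
  qed
qed

text \<open>If \<open>a\<close> is missing at \<open>y\<close>, swapping it along the chain of
  \<open>w\<close> with a color missing at \<open>x\<close> and \<open>w\<close> gives
  \<open>zw\<close> a color missing at \<open>x\<close>. That color must differ from
  \<open>a0\<close>; \<open>two\<close> guarantees a candidate at \<open>x\<close>, which is first
  made missing at \<open>w\<close> if necessary.\<close>

lemma kierstead:
  assumes N: "col x y N" and a0: "a0 \<in> K" "N a0 x = x" "N a0 y = z" "z \<noteq> y"
    and a: "a \<in> K" "N a x = x \<or> N a y = y" "a \<noteq> a0" "N a z = w"
    and w: "w \<noteq> z" "w \<noteq> x" "w \<noteq> y"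
    and d: "d \<in> K" "N d x = x \<or> N d y = y" "N d w = w"
    and e: "e \<in> K" "N e x = x \<or> N e y = y" "N e w = w" "d \<noteq> e"
    and two: "card (Ms N x) \<ge> 2"
  shows False
proof (cases "N a x = x")
  case True then show False using kierstead_x[OF N, OF a0 a(1) _ a(3,4) w d e] by blast
next
  case False
  then have ay: "N a y = y" using a by blast
  have aw: "N a w = z" by (rule col_back[OF N, OF a(1,4)])
  have main: False if M: "col x y M" and v: "M a0 x = x" "M a0 y = z" "M a y = y" "M a z = w"
    and d: "d \<in> K" "M d x = x" "M d w = w" "d \<noteq> a0"
    and e: "e \<in> K" "M e x = x \<or> M e y = y" "M e w = w" "d \<noteq> e" for M d e
  proof -
    have aw: "M a w = z" by (rule col_back[OF M, OF a(1) v(4)])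
    have da: "d \<noteq> a" "e \<noteq> a" using aw d e w by auto
    let ?C = "orb (M a) (M d) w"
    have out: "x \<notin> ?C" "y \<notin> ?C" using free_chain[OF M, OF a(1) d(1,2) v(3) w(2,3)] d(3) by blast+
    have z: "z \<in> ?C" using orb_back[OF M, OF a(1) d(1), of a z w] v(4) orb_refl by metis
    let ?P = "swp a d ?C M"
    have P: "col x y ?P" by (rule col_swp_orb[OF M, OF a(1) d(1)])
    have "?P a0 x = x" "?P a0 y = z" "?P d z = w" "?P a w = w" "?P a y = y" "?P d x = x"
      "?P e w = w" "?P e x = x \<or> ?P e y = y"
      using out z v a(3) d e da by (auto simp: swp_in orb_refl)
    then show False
      using kierstead_x[OF P, OF a0(1) _ _ a0(4) d(1) _ d(4) _ w a(1) _ _ e(1)] da by blast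
  qed
  have one: False if d: "d \<in> K" "N d x = x \<or> N d y = y" "N d w = w" "d \<noteq> a0"
    and e: "e \<in> K" "N e x = x \<or> N e y = y" "N e w = w" "d \<noteq> e" for d e
  proof (cases "N d x = x")
    case True then show False using main[OF N a0(2,3) ay a(4) d(1) _ d(3,4) e] by blast
  next
    case False
    then have dy: "N d y = y" using d by blast
    have da: "d \<noteq> a" "e \<noteq> a" using aw d e w by auto
    have "\<not> Ms N x \<subseteq> {a0}" using two card_mono[of "{a0}" "Ms N x"] by auto
    then obtain g where g: "g \<in> K" "N g x = x" "g \<noteq> a0" by (auto simp: Ms_def)
    have gd: "g \<noteq> d" using False g by auto
    have ga: "g \<noteq> a" using \<open>N a x \<noteq> x\<close> g by auto
    show False
    proof (cases "N g w = w")
      case True show False by (rule main[OF N a0(2,3) ay a(4) g(1,2) True g(3) d(1,2,3) gd])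
    next
      case gw: False
      then have eg: "e \<noteq> g" using e by auto
      let ?C = "orb (N d) (N g) w"
      have out: "x \<notin> ?C" "y \<notin> ?C" using free_chain[OF N, OF d(1) g(1,2) dy w(2,3)] d(3) by blast+
      let ?P = "swp d g ?C N"
      have P: "col x y ?P" by (rule col_swp_orb[OF N, OF d(1) g(1)])
      have "?P a0 x = x" "?P a0 y = z" "?P a y = y" "?P a z = w" "?P g x = x" "?P g w = w"
        "?P e w = w" "?P e x = x \<or> ?P e y = y"
        using out a0 ay a g gd ga da d e eg by (auto simp: swp_in orb_refl)
      then show False using main[OF P _ _ _ _ g(1) _ _ g(3) e(1)] eg by blast
    qed
  qed
  show False using one[of d e] one[of e d] d e by blast
qed

subsection \<open>Colors with low ends at two neighbours of a vertex\<close>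

text \<open>Swapping \<open>c\<close> and \<open>g\<close> at \<open>u\<close> frees
  \<open>c\<close> there, and then \<open>yu\<close> can change from \<open>k\<close> to
  \<open>c\<close>. The explicit form of \<open>M\<close> is kept because other colors have to be
  traced through the construction.\<close>

lemma make_missing:
  assumes N: "col x y N" and k: "k \<in> K" "N k y = u" "u \<noteq> y" "u \<noteq> x" "N k x \<noteq> x"
    and c: "c \<in> K" "N c y = y"
    and g: "g \<in> K" "N g x = x" "N g u = u"
  shows "\<exists>C M. col x y M \<and> x \<notin> C \<and> y \<notin> C \<and> M = swp k c {y, u} (swp c g C N) \<and>
     M k y = y \<and> M k u = u \<and> M c y = u \<and> N k u = y"
proof -
  let ?C = "orb (N c) (N g) u"
  have out: "x \<notin> ?C" "y \<notin> ?C" using free_chain[OF N, OF c(1) g(1,2) c(2) k(4,3)] g(3) by blast+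
  have kc: "k \<noteq> c" using k c by auto
  have kg: "k \<noteq> g" using k g by auto
  have ku: "N k u = y" by (rule col_back[OF N, OF k(1,2)])
  let ?N1 = "swp c g ?C N"
  have N1: "col x y ?N1" by (rule col_swp_orb[OF N, OF c(1) g(1)])
  have v1: "?N1 c u = u" "?N1 c y = y" "?N1 k y = u" "?N1 k u = y"
    using out g c k kc kg ku by (auto simp: swp_in orb_refl)
  let ?N2 = "swp k c {y, u} ?N1"
  have N2: "col x y ?N2" by (rule col_recolor[OF N1, OF k(1) c(1) v1(3,2,1)])
  have "?N2 k y = y" "?N2 k u = u" "?N2 c y = u" using v1 by (auto simp: swp_def)
  then show ?thesis using N2 out ku by blast
qed

text \<open>If one color is missing at \<open>x\<close>, \<open>u\<close> and \<open>u'\<close>, then swapping \<open>k\<close> with it along the chain of \<open>x\<close> misses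
  \<open>u\<close> or \<open>u'\<close> and creates a forbidden fan. Otherwise \<open>yu\<close> is recolored temporarily so that \<open>k\<close> becomes
  missing at \<open>y\<close>. Then \<open>zu'\<close> can be given a color missing at \<open>x\<close>, and after \<open>yu\<close> has got back its color
  \<open>k\<close>, there is a forbidden fan at \<open>z\<close>.\<close>

lemma two_low_ends:
  assumes N: "col x y N" and c: "c \<in> K" "N c y = y" "N c x = z" "z \<noteq> x"
    and k: "k \<in> K" "N k x \<noteq> x" "N k y = u" "u \<noteq> y" "N k z = u'" "u' \<noteq> z" "u \<noteq> x" "u' \<noteq> x"
    and g: "g \<in> K" "N g x = x" "N g u = u" and d: "d \<in> K" "N d x = x" "N d u = u" "g \<noteq> d"
    and g': "g' \<in> K" "N g' x = x" "N g' u' = u'" and d': "d' \<in> K" "N d' x = x" "N d' u' = u'" "g' \<noteq> d'"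
  shows False
proof -
  have xy: "x \<noteq> y" by (rule col_neq[OF N])
  have zy: "z \<noteq> y" using col_xy(1)[OF N, OF c(1)] c(3) by blast
  have uz: "u \<noteq> z"
    using fan_x[OF col_sym[OF N], OF c(1,2,3,4)] fan_y[OF col_sym[OF N], OF c(1,2,3,4) g(1,2)] g(3) by blast
  have u'y: "u' \<noteq> y"
  proof
    assume "u' = y"
    then have "N k y = z" using col_back[OF N, OF k(1,5)] by simp
    then show False using k uz by simp
  qed
  have uu: "u \<noteq> u'"
  proof
    assume "u = u'"
    then have "N k u = y" "N k u = z" using col_back[OF N, OF k(1,3)] col_back[OF N, OF k(1,5)] by auto
    then show False using zy by simp
  qed
  have ku: "N k u = y" by (rule col_back[OF N, OF k(1,3)])
  have ku': "N k u' = z" by (rule col_back[OF N, OF k(1,5)])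
  have cx: "N c z = x" by (rule col_back[OF N, OF c(1,3)])
  have kc: "k \<noteq> c" using c k by auto
  have kx: "k \<noteq> f" if "N f x = x" for f using that k by auto
  have cx': "c \<noteq> f" if "N f x = x" for f using that c by auto
  have common: False if f: "f \<in> K" "N f x = x" "N f u = u" "N f u' = u'"
    and p: "p \<in> K" "N p x = x" "N p u = u" "p \<noteq> f"
    and q: "q \<in> K" "N q x = x" "N q u' = u'" "q \<noteq> f" for f p q
  proof -
    let ?C = "orb (N k) (N f) x"
    let ?M = "swp k f ?C N"
    have M: "col x y ?M" by (rule col_swp_orb[OF N, OF k(1) f(1)])
    have xM: "?M k x = x" by (simp add: swp_in orb_refl f)
    have "u \<notin> ?C \<or> u' \<notin> ?C"
      using orb_ends'[OF N, OF k(1) f(1), of x u u'] f k uu by auto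
    then show False
    proof
      assume "u \<notin> ?C"
      then have y: "y \<notin> ?C" using orb_back[OF N, OF k(1) f(1), of k y u] k by blast
      have "?M k y = u" "?M p x = x" "?M p u = u" using y \<open>u \<notin> ?C\<close> k p kx[of p] by auto
      then show False using fan_x[OF M, OF k(1) xM _ k(4) p(1)] by blast
    next
      assume u': "u' \<notin> ?C"
      then have z: "z \<notin> ?C" using orb_back[OF N, OF k(1) f(1), of k z u'] k by blast
      have v: "?M c y = y" "?M c x = z" "?M k z = u'" "?M q x = x" "?M q u' = u'"
        using z u' c k q kx[of q] cx'[of f] kc f by auto
      have S: "col x z (shf c x y ?M)" by (rule col_shf[OF M, OF c(1) v(2) c(4) v(1)])
      have "shf c x y ?M q x = x" "shf c x y ?M q u' = u'" "shf c x y ?M k x = x" "shf c x y ?M k z = u'"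
        using v xM cx'[of q] q kc by auto
      then show False using fan_x[OF S, OF k(1) _ _ k(6) q(1)] by blast
    qed
  qed
  show False
  proof (cases "\<exists>f\<in>K. N f x = x \<and> N f u = u \<and> N f u' = u'")
    case True
    then obtain f where f: "f \<in> K" "N f x = x" "N f u = u" "N f u' = u'" by blast
    obtain p where "p \<in> K" "N p x = x" "N p u = u" "p \<noteq> f" using g d by metis
    moreover obtain q where "q \<in> K" "N q x = x" "N q u' = u'" "q \<noteq> f" using g' d' by metis
    ultimately show False using common[OF f] by blast
  next
    case False
    then have ne: "g \<noteq> g'" "g \<noteq> d'" "d \<noteq> g'" "d \<noteq> d'" using g d g' d' by auto
    obtain C M where M: "col x y M" and out: "x \<notin> C" "y \<notin> C"
      and M_def: "M = swp k c {y, u} (swp c g C N)"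
      and vM: "M k y = y" "M k u = u" "M c y = u"
      using make_missing[OF N, OF k(1,3,4,7,2) c(1,2) g] by blast
    have oM: "M f = N f" if "f \<noteq> k" "f \<noteq> c" "f \<noteq> g" for f using that unfolding M_def by (intro ext) simp
    have xM: "M f x = N f x" for f using out xy k(7) unfolding M_def by simp
    have kM: "M k z = u'" "M k u' = z"
      using uz zy u'y uu kc kx[of g] g k ku' unfolding M_def by auto
    have dM: "M d u = u" "M g' u' = u'" "M d' u' = u'" "M g' x = x" "M d' x = x" "M d x = x"
      using d g' d' ne kx[of d] kx[of g'] kx[of d'] cx'[of d] cx'[of g'] cx'[of d'] by (auto simp: oM)
    let ?D = "orb (M k) (M g') u'"
    have outD: "x \<notin> ?D" "y \<notin> ?D"
      using free_chain[OF M, OF k(1) g'(1) dM(4) vM(1) k(8) u'y] dM(2) by blast+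
    have zD: "z \<in> ?D" using orb_back[OF M, OF k(1) g'(1), of k z u'] kM(1) orb_refl by metis
    let ?P = "swp k g' ?D M"
    have P: "col x y ?P" by (rule col_swp_orb[OF M, OF k(1) g'(1)])
    have cg': "c \<noteq> g'" "c \<noteq> d" "c \<noteq> d'" using cx' g' d d' by blast+
    have kg': "k \<noteq> g'" "k \<noteq> d" "k \<noteq> d'" using kx g' d d' by blast+
    have vP: "?P g' z = u'" "?P c y = u" "?P k y = y" "?P d u = u" "?P d' u' = u'"
      and xP: "?P f x = N f x" for f
      using zD kM outD vM cg' kg' kc dM ne d'(4) xM by (auto simp: swp_in)
    \<comment> \<open>To give \<open>yu\<close> its color \<open>k\<close> back, \<open>k\<close>
      must be missing at \<open>u\<close>, which the last swap may have spoiled. For that case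
      \<open>d\<close> was held in reserve: it is missing at \<open>x\<close> and \<open>u\<close>,
      and a free chain trades it for \<open>k\<close>.\<close>
    obtain Q where Q: "col x y Q" and xQ: "\<And>f. Q f x = N f x"
      and vQ: "Q g' z = u'" "Q c y = u" "Q k y = y" "Q d' u' = u'" "Q k u = u"
    proof (cases "?P k u = u")
      case True then show ?thesis using that[OF P] xP vP by blast
    next
      case F: False
      let ?F = "orb (?P k) (?P d) u"
      have outF: "x \<notin> ?F" "y \<notin> ?F"
        using free_chain[OF P, OF k(1) d(1) _ vP(3) k(7,4)] vP(4) xP[of d] d(2) by auto
      let ?Q = "swp k d ?F ?P"
      have Q: "col x y ?Q" by (rule col_swp_orb[OF P, OF k(1) d(1)])
      show ?thesis
        by (rule that[OF Q]) (use outF xP vP kg' kc cg' ne in \<open>auto simp: swp_in orb_refl\<close>)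
    qed
    let ?R = "swp c k {y, u} Q"
    have R: "col x y ?R" by (rule col_recolor[OF Q, OF c(1) k(1) vQ(2,3,5)])
    have vR: "?R c y = y" "?R c x = z" "?R g' z = u'" "?R g' x = x" "?R d' x = x" "?R d' u' = u'"
      using vQ xQ xy k(7) c g' d' zy uz uu u'y by (auto simp: swp_def)
    have S: "col x z (shf c x y ?R)" by (rule col_shf[OF R, OF c(1) vR(2) c(4) vR(1)])
    have "shf c x y ?R g' z = u'" "shf c x y ?R g' x = x" "shf c x y ?R d' x = x" "shf c x y ?R d' u' = u'"
      using vR cg' by auto
    then show False using fan_x[OF S, OF g'(1) _ _ k(6) d'(1)] by blast
  qed
qed

subsection \<open>Vertices at distance two\<close>

text \<open>If \<open>w\<close> were off the chain, the swap at \<open>x\<close> would make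
  \<open>a\<close> missing at \<open>x\<close> and leave the path and the colors \<open>d\<close>,
  \<open>e\<close> intact, which \<open>kierstead_x\<close> excludes. A third color is required
  because the swap uses up \<open>g\<close>.\<close>

lemma distance_two_chain:
  assumes N: "col x y N" and a0: "a0 \<in> K" "N a0 x = x" "N a0 y = z" "z \<noteq> y"
    and a: "a \<in> K" "N a x \<noteq> x" "N a z = w" and w: "w \<noteq> z" "w \<noteq> x" "w \<noteq> y"
    and g: "g \<in> K" "N g x = x" "N g w = w" "g \<noteq> a0"
    and d: "d \<in> K" "N d x = x" "N d w = w" "d \<noteq> g"
    and e: "e \<in> K" "N e x = x" "N e w = w" "e \<noteq> g" "e \<noteq> d"
  shows "w \<in> orb (N a) (N g) x"
proof (rule ccontr)
  let ?C = "orb (N a) (N g) x"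
  assume out: "w \<notin> ?C"
  then have z: "z \<notin> ?C" using orb_back[OF N, OF a(1) g(1), of a z w] a by blast
  let ?M = "swp a g ?C N"
  have M: "col x y ?M" by (rule col_swp_orb[OF N, OF a(1) g(1)])
  have aa: "a \<noteq> a0" "a \<noteq> d" "a \<noteq> e" using a a0 d e by auto
  have v: "?M a0 x = x" "?M a0 y = z" "?M a x = x" "?M a z = w" "?M d x = x" "?M d w = w"
    "?M e x = x" "?M e w = w"
    using out z aa a0 a g d e by (auto simp: swp_in orb_refl)
  show False
    by (rule kierstead_x[OF M, OF a0(1) v(1,2) a0(4) a(1) v(3) aa(1) v(4) w d(1) _ v(6) e(1) _ v(8)])
       (use v e in auto)
qed

lemma distance_two_disjoint:
  assumes N: "col x y N" and a: "a \<in> K" "N a x \<noteq> x"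
    and w: "w \<noteq> x" "w \<in> orb (N a) (N g) x" and w': "w' \<noteq> x" "w' \<in> orb (N a) (N g) x"
    and g: "g \<in> K" "N g x = x" "N g w = w" "N g w' = w'"
  shows "w = w'"
  using orb_ends'[OF N, OF a(1) g(1), of x w w'] assms by auto

subsection \<open>Adjacency lemmas\<close>

lemma card_present: "col x y N \<Longrightarrow> card (K - Ms N x) + 1 = dg x"
proof -
  assume N: "col x y N"
  have "y \<in> nb x" using N by (simp add: col_def nb_def)
  then have "dg x > 0" using fin_nb by (auto simp: dg_def card_gt_0_iff)
  then show ?thesis
    using card_Ms_x[OF N] dg_le[of x] card_Diff_subset[OF fin_Ms Ms_K, of N x] card_K by linarith
qed

lemma degree_sum:
  assumes "y \<in> nb x" shows "\<Delta> + 2 \<le> dg x + dg y"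
proof -
  obtain N where N: "col x y N" using assms col_exists by (auto simp: nb_def)
  have "card (Ms N x \<union> Ms N y) \<le> \<Delta>"
    using card_mono[OF fin_K, of "Ms N x \<union> Ms N y"] Ms_K[of N] card_K by auto
  then show ?thesis
    using card_Un_disjoint[OF fin_Ms fin_Ms Ms_disj[OF N]] card_Ms_x[OF N] card_Ms_y[OF N] by linarith
qed

lemma no_isolated:
  assumes "v \<in> V" shows "nb v \<noteq> {}"
proof
  assume v: "nb v = {}"
  have "proper_subgraph (V - {v}) E V E"
  proof -
    have "v \<notin> e" if e: "e \<in> E" for e
    proof
      assume "v \<in> e"
      obtain a c where "e = {a, c}" using E_card[OF e] card_2_iff by metis
      then show False using \<open>v \<in> e\<close> e v by (auto simp: nb_def insert_commute)
    qed
    then show ?thesis using finV E_sub E_card assms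
      by (simp add: proper_subgraph_def simple_graph_def) blast
  qed
  then have "chromatic_index E \<le> \<Delta>" using critical unfolding edge_critical_def by blast
  moreover have "chromatic_index E = \<Delta> + 1" using critical unfolding edge_critical_def by blast
  ultimately show False by simp
qed

lemma card_colors:
  assumes N: "col x y N"
  shows "card {k \<in> K. N k v \<noteq> v \<and> Q (N k v)} = card {u \<in> nb v. {v, u} \<noteq> {x, y} \<and> Q u}"
proof -
  have "bij_betw (\<lambda>k. N k v) {k \<in> K. N k v \<noteq> v \<and> Q (N k v)} {u \<in> nb v. {v, u} \<noteq> {x, y} \<and> Q u}"
    unfolding bij_betw_def
  proof (intro conjI equalityI subsetI)
    show "inj_on (\<lambda>k. N k v) {k \<in> K. N k v \<noteq> v \<and> Q (N k v)}"
      using col_inj[OF N] by (auto simp: inj_on_def)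
    fix u assume "u \<in> (\<lambda>k. N k v) ` {k \<in> K. N k v \<noteq> v \<and> Q (N k v)}"
    then obtain k where "k \<in> K" "N k v \<noteq> v" "Q (N k v)" "u = N k v" by blast
    then show "u \<in> {u \<in> nb v. {v, u} \<noteq> {x, y} \<and> Q u}"
      using col_edge[OF N, of k v] col_edge'[OF N, of k v] by (simp add: nb_def)
  next
    fix u assume u: "u \<in> {u \<in> nb v. {v, u} \<noteq> {x, y} \<and> Q u}"
    then obtain k where k: "k \<in> K" "N k v = u" using col_ex[OF N, of v u] by (auto simp: nb_def)
    moreover have "u \<noteq> v" using u nb_irrefl by blast
    ultimately show "u \<in> (\<lambda>k. N k v) ` {k \<in> K. N k v \<noteq> v \<and> Q (N k v)}" using u by blast
  qed
  then show ?thesis by (rule bij_betw_same_card)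
qed

lemma common_missing_any:
  assumes N: "col x y N" and u: "u \<noteq> x" "u \<noteq> y"
  shows "\<Delta> + 1 \<le> card (Ms N u \<inter> Ms N x) + dg u + dg x"
proof -
  have "Ms N u \<subseteq> (Ms N u \<inter> Ms N x) \<union> (K - Ms N x)" using Ms_K by blast
  then have "card (Ms N u) \<le> card ((Ms N u \<inter> Ms N x) \<union> (K - Ms N x))"
    by (rule card_mono[rotated]) (simp add: fin_Ms fin_K)
  also have "\<dots> \<le> card (Ms N u \<inter> Ms N x) + card (K - Ms N x)" by (rule card_Un_le)
  finally show ?thesis using card_present[OF N] card_Ms_other[OF N u] by linarith
qed

text \<open>\<open>k\<close> is present at \<open>x\<close> and not missing at \<open>u\<close>, so
  at most \<open>dg x - 2\<close> colors missing at \<open>u\<close> are present at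
  \<open>x\<close>. The extra 1 over \<open>common_missing_any\<close> yields two common colors when
  \<open>dg u + dg x \<le> \<Delta>\<close>.\<close>

lemma common_missing:
  assumes N: "col x y N" and u: "u \<noteq> x" "u \<noteq> y" and k: "k \<in> K" "N k x \<noteq> x" "N k u \<noteq> u"
  shows "\<Delta> + 2 \<le> card (Ms N u \<inter> Ms N x) + dg u + dg x"
proof -
  have "Ms N u \<subseteq> (Ms N u \<inter> Ms N x) \<union> (K - Ms N x - {k})" using Ms_K k by (auto simp: Ms_def)
  then have "card (Ms N u) \<le> card ((Ms N u \<inter> Ms N x) \<union> (K - Ms N x - {k}))"
    by (rule card_mono[rotated]) (simp add: fin_Ms fin_K)
  also have "\<dots> \<le> card (Ms N u \<inter> Ms N x) + card (K - Ms N x - {k})" by (rule card_Un_le)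
  finally have "card (Ms N u) \<le> card (Ms N u \<inter> Ms N x) + card (K - Ms N x - {k})" .
  moreover have "card (K - Ms N x - {k}) + 1 = card (K - Ms N x)"
  proof -
    have "k \<in> K - Ms N x" using k by (simp add: Ms_def)
    then show ?thesis using card_Suc_Diff1[of "K - Ms N x" k] fin_K by simp
  qed
  ultimately show ?thesis using card_present[OF N] card_Ms_other[OF N u] by linarith
qed

lemma two_elements:
  assumes "2 \<le> card A" shows "\<exists>a\<in>A. \<exists>b\<in>A. a \<noteq> b"
proof -
  have "finite A" using assms by (intro card_ge_0_finite) simp
  then have "(card A \<le> Suc 0) = (\<forall>a\<in>A. \<forall>b\<in>A. a = b)" by (rule card_le_Suc0_iff_eq)
  moreover have "\<not> card A \<le> Suc 0" using assms by simp
  ultimately show ?thesis by blast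
qed

lemma low_common:
  assumes N: "col x y N" and u: "u \<noteq> x" "u \<noteq> y" "dg u + dg x \<le> \<Delta>"
    and k: "k \<in> K" "N k x \<noteq> x" "N k v = u" "u \<noteq> v"
  obtains g d where "g \<in> K" "d \<in> K" "N g x = x" "N d x = x" "N g u = u" "N d u = u" "g \<noteq> d"
proof -
  have "N k u \<noteq> u" using col_back[OF N k(1,3)] k(4) by auto
  then have "2 \<le> card (Ms N u \<inter> Ms N x)" using common_missing[OF N u(1,2) k(1,2)] u(3) by linarith
  then show ?thesis using two_elements[of "Ms N u \<inter> Ms N x"] that by (auto simp: Ms_def)
qed

lemma low_not_missing:
  assumes N: "col x y N" and k: "k \<in> K" "N k y = u" "u \<noteq> y" and u: "dg u + dg x \<le> \<Delta>"
  shows "N k x \<noteq> x"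
proof
  assume x: "N k x = x"
  have ux: "u \<noteq> x" using col_xy(2)[OF N k(1)] k(2) by blast
  have "card (Ms N u \<inter> Ms N x) > 0" using common_missing_any[OF N ux k(3)] u by linarith
  then obtain g where "g \<in> Ms N u" "g \<in> Ms N x" by (auto simp: card_gt_0_iff)
  then show False using fan_x[OF N, OF k(1) x k(2,3)] by (auto simp: Ms_def)
qed

text \<open>The vertex \<open>x\<close> itself is counted whether or not it satisfies \<open>P\<close>. Including the deficit
  \<open>\<Delta> - dg y\<close> makes the counts comparable between neighbours of different degree.\<close>

definition low_count :: "('a \<Rightarrow> bool) \<Rightarrow> 'a \<Rightarrow> 'a \<Rightarrow> nat" where
  "low_count P x y = card {u \<in> nb y - {x}. P u} + 1 + (\<Delta> - dg y)"

text \<open>Four sets of colors present at \<open>x\<close> are disjoint: those missing at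
  \<open>y\<close>, those missing at \<open>z\<close>, and those leading from \<open>y\<close> or
  from \<open>z\<close> to a low vertex other than \<open>x\<close>. Only \<open>dg x - 1\<close>
  colors are present at \<open>x\<close>, and the two counts together exceed the total size of the
  sets by 1.\<close>

lemma low_count_add:
  assumes N: "col x y N" and c: "c \<in> K" "N c y = y" "N c x = z"
    and P: "\<And>u. P u \<Longrightarrow> dg u + dg x \<le> \<Delta>"
  shows "low_count P x y + low_count P x z \<le> dg x"
proof -
  have zx: "z \<noteq> x" using col_disj[OF col_sym[OF N] c(1,2)] c(3) by auto
  have xy: "x \<noteq> y" by (rule col_neq[OF N])
  have zy: "z \<noteq> y" using col_xy(1)[OF N c(1)] c(3) by blast
  have Nyx: "col y x N" by (rule col_sym[OF N])
  let ?S = "shf c x y N"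
  have S: "col x z ?S" by (rule col_shf[OF N, OF c(1,3) zx c(2)])
  note s = shf_at[OF N, OF c(1,3) zx c(2)]
  have Szx: "col z x ?S" by (rule col_sym[OF S])
  have "y \<in> nb x" "z \<in> nb x" using N S by (auto simp: col_def nb_def)
  then have nPy: "\<not> P y" and nPz: "\<not> P z" using degree_sum[of _ x] P by fastforce+
  define Hy where "Hy = {k \<in> K. N k y \<noteq> y \<and> P (N k y)}"
  define Hz where "Hz = {k \<in> K. N k z \<noteq> z \<and> (N k z \<noteq> x \<and> P (N k z))}"
  have cHy: "card Hy = card {u \<in> nb y - {x}. P u}"
  proof -
    have "{u \<in> nb y. {y, u} \<noteq> {x, y} \<and> P u} = {u \<in> nb y - {x}. P u}" using xy by (auto simp: doubleton_eq_iff)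
    then show ?thesis unfolding Hy_def using card_colors[OF N, of y P] by simp
  qed
  have cHz: "card Hz = card {u \<in> nb z - {x}. P u}"
  proof -
    have "{u \<in> nb z. {z, u} \<noteq> {x, y} \<and> (u \<noteq> x \<and> P u)} = {u \<in> nb z - {x}. P u}"
      using zx zy by (auto simp: doubleton_eq_iff)
    then show ?thesis unfolding Hz_def using card_colors[OF N, of z "\<lambda>u. u \<noteq> x \<and> P u"] by simp
  qed
  have ck: "c \<notin> Hz" "c \<notin> Hy" using col_back[OF N, OF c(1,3)] c(2) by (auto simp: Hz_def Hy_def)
  have Hy_S: "k \<in> K - Ms N x" if "k \<in> Hy" for k
    using low_not_missing[OF N, of k] that P by (auto simp: Hy_def Ms_def)
  have Hz_S: "k \<in> K - Ms N x" if k: "k \<in> Hz" for k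
  proof -
    have "k \<noteq> c" using ck k by blast
    then show ?thesis
      using low_not_missing[OF S, of k] k P by (auto simp: Hz_def Ms_def)
  qed
  have Hz_y: "N k z \<noteq> y" if "k \<in> Hz" for k using that nPy by (auto simp: Hz_def)
  have Hy_z: "N k y \<noteq> z" if "k \<in> Hy" for k using that nPz by (auto simp: Hy_def)
  have Hy_x: "N k y \<noteq> x" if "k \<in> Hy" for k using that col_xy(2)[OF N] by (auto simp: Hy_def)
  have d1: "Hy \<inter> Hz = {}"
  proof (rule ccontr)
    assume "Hy \<inter> Hz \<noteq> {}"
    then obtain k where k: "k \<in> Hy" "k \<in> Hz" by blast
    note h = Hy_S[OF k(1)] Hz_y[OF k(2)] Hy_x[OF k(1)]
    have k': "k \<in> K" "N k x \<noteq> x" "N k y \<noteq> y" "N k z \<noteq> z" "N k z \<noteq> x"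
      using k h by (auto simp: Hy_def Hz_def Ms_def)
    have lo: "dg (N k y) + dg x \<le> \<Delta>" "dg (N k z) + dg x \<le> \<Delta>" using k P by (auto simp: Hy_def Hz_def)
    obtain g d where g: "g \<in> K" "d \<in> K" "N g x = x" "N d x = x" "N g (N k y) = N k y"
      "N d (N k y) = N k y" "g \<noteq> d"
      using low_common[OF N h(3) k'(3) lo(1) k'(1,2) refl k'(3)] by blast
    obtain g' d' where g': "g' \<in> K" "d' \<in> K" "N g' x = x" "N d' x = x" "N g' (N k z) = N k z"
      "N d' (N k z) = N k z" "g' \<noteq> d'"
      using low_common[OF N k'(5) h(2) lo(2) k'(1,2) refl k'(4)] by blast
    show False
      using two_low_ends[OF N c zx k'(1,2) refl k'(3) refl k'(4) h(3) k'(5) g(1,3,5,2,4,6,7) g'(1,3,5,2,4,6,7)] .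
  qed
  have z_x: "Ms N z \<inter> Ms N x = {}"
    using fan_y[OF Nyx, OF c zx] by (auto simp: Ms_def)
  have z_y: "Ms N z \<inter> Ms N y = {}"
    using fan_x[OF Nyx, OF c zx] by (auto simp: Ms_def)
  have y_Hz: "Ms N y \<inter> Hz = {}"
  proof (rule ccontr)
    assume "Ms N y \<inter> Hz \<noteq> {}"
    then obtain k where k: "k \<in> Ms N y" "k \<in> Hz" by blast
    note h = Hz_S[OF k(2)] Hz_y[OF k(2)]
    have k': "k \<in> K" "N k x \<noteq> x" "N k y = y" "N k z \<noteq> z" "N k z \<noteq> x" "k \<noteq> c"
      using k h ck by (auto simp: Hz_def Ms_def)
    have lo: "dg (N k z) + dg x \<le> \<Delta>" using k P by (auto simp: Hz_def)
    obtain g d where g: "g \<in> K" "d \<in> K" "N g x = x" "N d x = x" "N g (N k z) = N k z"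
      "N d (N k z) = N k z" "g \<noteq> d"
      using low_common[OF N k'(5) h(2) lo k'(1,2) refl k'(4)] by blast
    show False
      using kierstead_x[OF Nyx, OF c zx k'(1,3,6) refl k'(4) h(2) k'(5) g(1) _ g(5) g(2) _ g(6,7)] g by blast
  qed
  have z_Hy: "Ms N z \<inter> Hy = {}"
  proof (rule ccontr)
    assume "Ms N z \<inter> Hy \<noteq> {}"
    then obtain k where k: "k \<in> Ms N z" "k \<in> Hy" by blast
    note h = Hy_S[OF k(2)] Hy_z[OF k(2)] Hy_x[OF k(2)]
    have k': "k \<in> K" "N k x \<noteq> x" "N k z = z" "N k y \<noteq> y" "k \<noteq> c"
      using k h ck by (auto simp: Hy_def Ms_def)
    have lo: "dg (N k y) + dg x \<le> \<Delta>" using k P by (auto simp: Hy_def)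
    obtain g d where g: "g \<in> K" "d \<in> K" "N g x = x" "N d x = x" "N g (N k y) = N k y"
      "N d (N k y) = N k y" "g \<noteq> d"
      using low_common[OF N h(3) k'(4) lo k'(1,2) refl k'(4)] by blast
    have gc: "g \<noteq> c" "d \<noteq> c" using g c zx by auto
    show False
      using kierstead_x[OF Szx, OF c(1) s(3,1) xy[symmetric] k'(1) _ k'(5) _ k'(4) h(2,3) g(1) _ _ g(2) _ _ g(7)]
        k' g gc by simp
  qed
  have "Ms N y \<inter> Hy = {}" "Ms N z \<inter> Hz = {}" by (auto simp: Ms_def Hy_def Hz_def)
  note disj = this d1 z_y y_Hz z_Hy
  have fin: "finite Hy" "finite Hz" using fin_K by (auto simp: Hy_def Hz_def)
  have "card (Hy \<union> Hz \<union> Ms N y \<union> Ms N z) = card Hy + card Hz + card (Ms N y) + card (Ms N z)"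
    using disj fin fin_Ms[of N] by (subst card_Un_disjoint, auto)+
  moreover have "Hy \<union> Hz \<union> Ms N y \<union> Ms N z \<subseteq> K - Ms N x"
    using Hy_S Hz_S Ms_disj[OF N] z_x Ms_K[of N] by blast
  then have "card (Hy \<union> Hz \<union> Ms N y \<union> Ms N z) \<le> card (K - Ms N x)"
    using fin_K by (intro card_mono) auto
  ultimately show ?thesis
    using cHy cHz card_present[OF N] card_Ms_y[OF N] card_Ms_other[OF N zx zy] dg_le[of y] dg_le[of z]
    unfolding low_count_def by linarith
qed

text \<open>The colors missing at \<open>y\<close> and the colors leading from \<open>y\<close> to a low vertex both yield suitable
  neighbours of \<open>x\<close>, since a color of the second kind can be made missing at \<open>y\<close>.\<close>

lemma low_count_le_card:
  assumes y: "y \<in> nb x" and P: "\<And>u. P u \<Longrightarrow> dg u + dg x \<le> \<Delta>"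
  shows "low_count P x y \<le> card {z \<in> nb x - {y}. low_count P x y + low_count P x z \<le> dg x}"
proof -
  obtain N where N: "col x y N" using y col_exists by (auto simp: nb_def)
  have xy: "x \<noteq> y" by (rule col_neq[OF N])
  define Hy where "Hy = {k \<in> K. N k y \<noteq> y \<and> P (N k y)}"
  have cHy: "card Hy = card {u \<in> nb y - {x}. P u}"
  proof -
    have "{u \<in> nb y. {y, u} \<noteq> {x, y} \<and> P u} = {u \<in> nb y - {x}. P u}" using xy by (auto simp: doubleton_eq_iff)
    then show ?thesis unfolding Hy_def using card_colors[OF N, of y P] by simp
  qed
  have finH: "finite Hy" using fin_K by (simp add: Hy_def)
  have HyS: "N k x \<noteq> x" if "k \<in> Hy" for k
    using low_not_missing[OF N, of k] that P by (auto simp: Hy_def)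
  have nx: "N k x \<noteq> x" if "k \<in> Ms N y \<union> Hy" for k
    using that HyS col_disj[OF N, of k] by (auto simp: Ms_def)
  have kK: "k \<in> K" if "k \<in> Ms N y \<union> Hy" for k using that by (auto simp: Ms_def Hy_def)
  have good: "low_count P x y + low_count P x (N k x) \<le> dg x" if "k \<in> Ms N y \<union> Hy" for k
  proof (cases "k \<in> Ms N y")
    case True then show ?thesis using low_count_add[OF N, of k "N k x" P] P by (auto simp: Ms_def)
  next
    case False
    then have k: "k \<in> Hy" using that by blast
    have k': "k \<in> K" "N k y \<noteq> y" "N k x \<noteq> x" using k HyS by (auto simp: Hy_def)
    have ux: "N k y \<noteq> x" by (rule col_xy(2)[OF N k'(1)])
    have lo: "dg (N k y) + dg x \<le> \<Delta>" using k P by (auto simp: Hy_def)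
    obtain g where g: "g \<in> K" "N g x = x" "N g (N k y) = N k y"
      using low_common[OF N ux k'(2) lo k'(1,3) refl k'(2)] by blast
    obtain c where c: "c \<in> K" "N c y = y" using ex_missing[OF N] by blast
    obtain C M where M: "col x y M" "x \<notin> C" "M = swp k c {y, N k y} (swp c g C N)" "M k y = y"
      using make_missing[OF N, OF k'(1) refl k'(2) ux k'(3) c g] by blast
    have "M k x = N k x" using M xy ux by simp
    then show ?thesis using low_count_add[OF M(1) k'(1) M(4), of "N k x" P] P by simp
  qed
  have "inj_on (\<lambda>k. N k x) (Ms N y \<union> Hy)"
    using col_inj[OF N] nx kK by (auto simp: inj_on_def)
  then have "card (Ms N y \<union> Hy) = card ((\<lambda>k. N k x) ` (Ms N y \<union> Hy))" by (simp add: card_image)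
  also have "\<dots> \<le> card {z \<in> nb x - {y}. low_count P x y + low_count P x z \<le> dg x}"
  proof (rule card_mono)
    show "finite {z \<in> nb x - {y}. low_count P x y + low_count P x z \<le> dg x}" using fin_nb by simp
    show "(\<lambda>k. N k x) ` (Ms N y \<union> Hy) \<subseteq> {z \<in> nb x - {y}. low_count P x y + low_count P x z \<le> dg x}"
    proof
      fix z assume "z \<in> (\<lambda>k. N k x) ` (Ms N y \<union> Hy)"
      then obtain k where k: "k \<in> Ms N y \<union> Hy" "z = N k x" by blast
      have "z \<in> nb x" using col_edge[OF N kK[OF k(1)] nx[OF k(1)]] k(2) by (simp add: nb_def)
      moreover have "z \<noteq> y" using col_xy(1)[OF N kK[OF k(1)]] k(2) by simp
      ultimately show "z \<in> {z \<in> nb x - {y}. low_count P x y + low_count P x z \<le> dg x}"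
        using good[OF k(1)] k(2) by simp
    qed
  qed
  also have "card (Ms N y \<union> Hy) = card (Ms N y) + card Hy"
    by (rule card_Un_disjoint[OF fin_Ms finH]) (auto simp: Ms_def Hy_def)
  finally show ?thesis using cHy card_Ms_y[OF N] dg_le[of y] by (simp add: low_count_def)
qed

text \<open>The fan lemmas make the missing sets of \<open>x\<close>, of \<open>y\<close> and of all
  vertices in \<open>B\<close> pairwise disjoint, so their sizes add up to at most
  \<open>\<Delta>\<close>.\<close>

lemma fan_image:
  assumes N: "col x y N"
  defines "B \<equiv> (\<lambda>c. N c y) ` Ms N x"
  shows "B \<subseteq> nb y - {x}" "card B + dg x = \<Delta> + 1"
    "(\<Sum>v\<in>B. \<Delta> - dg v) + (\<Delta> - dg y) + 2 \<le> dg x"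
proof -
  have ny: "N c y \<noteq> y" if "c \<in> Ms N x" for c using col_disj[OF N, of c] that by (simp add: Ms_def)
  have cK: "c \<in> K" "N c x = x" if "c \<in> Ms N x" for c using that by (auto simp: Ms_def)
  show B: "B \<subseteq> nb y - {x}"
  proof
    fix v assume "v \<in> B"
    then obtain c where c: "c \<in> Ms N x" "v = N c y" by (auto simp: B_def)
    then show "v \<in> nb y - {x}"
      using col_edge[OF N cK(1)[OF c(1)] ny[OF c(1)]] col_xy(2)[OF N cK(1)[OF c(1)]] by (simp add: nb_def)
  qed
  have "inj_on (\<lambda>c. N c y) (Ms N x)" using col_inj[OF N] ny cK(1) by (auto simp: inj_on_def)
  then show cB: "card B + dg x = \<Delta> + 1" using card_Ms_x[OF N] by (simp add: B_def card_image)
  have finB: "finite B" using fin_Ms by (simp add: B_def)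
  have bx: "v \<noteq> x" "v \<noteq> y" if "v \<in> B" for v using that B nb_irrefl by blast+
  have dj: "Ms N v \<inter> Ms N v' = {}" if vv: "v \<in> B" "v' \<in> B" "v \<noteq> v'" for v v'
  proof -
    obtain c c' where c: "c \<in> Ms N x" "v = N c y" "c' \<in> Ms N x" "v' = N c' y" using vv by (auto simp: B_def)
    show ?thesis
      using fan_pair[OF N cK(1)[OF c(1)] cK(2)[OF c(1)] refl ny[OF c(1)]
          cK(1)[OF c(3)] cK(2)[OF c(3)] refl ny[OF c(3)]] c vv(3) by (auto simp: Ms_def)
  qed
  have dxy: "Ms N v \<inter> (Ms N x \<union> Ms N y) = {}" if v: "v \<in> B" for v
  proof -
    obtain c where c: "c \<in> Ms N x" "v = N c y" using v by (auto simp: B_def)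
    show ?thesis
      using fan_x[OF N, OF cK(1)[OF c(1)] cK(2)[OF c(1)] refl ny[OF c(1)]]
        fan_y[OF N, OF cK(1)[OF c(1)] cK(2)[OF c(1)] refl ny[OF c(1)]] c by (auto simp: Ms_def)
  qed
  have "card (\<Union>v\<in>B. Ms N v) = (\<Sum>v\<in>B. card (Ms N v))"
    using dj finB fin_Ms by (intro card_UN_disjoint) auto
  also have "\<dots> = (\<Sum>v\<in>B. \<Delta> - dg v)"
  proof (rule sum.cong[OF refl])
    fix v assume "v \<in> B"
    then show "card (Ms N v) = \<Delta> - dg v" using card_Ms_other[OF N bx[of v]] by simp
  qed
  finally have U: "card (\<Union>v\<in>B. Ms N v) = (\<Sum>v\<in>B. \<Delta> - dg v)" .
  have "card ((\<Union>v\<in>B. Ms N v) \<union> (Ms N x \<union> Ms N y)) = card (\<Union>v\<in>B. Ms N v) + card (Ms N x \<union> Ms N y)"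
    using dxy finB fin_Ms by (intro card_Un_disjoint) auto
  moreover have "card (Ms N x \<union> Ms N y) = card (Ms N x) + card (Ms N y)"
    using card_Un_disjoint[OF fin_Ms fin_Ms Ms_disj[OF N]] .
  moreover have "card ((\<Union>v\<in>B. Ms N v) \<union> (Ms N x \<union> Ms N y)) \<le> card K"
    using Ms_K[of N] by (intro card_mono[OF fin_K]) blast
  ultimately show "(\<Sum>v\<in>B. \<Delta> - dg v) + (\<Delta> - dg y) + 2 \<le> dg x"
    using U card_Ms_x[OF N] card_Ms_y[OF N] card_K dg_le[of x] dg_le[of y] by linarith
qed

lemma fan_set:
  assumes "y \<in> nb x"
  shows "\<exists>B. B \<subseteq> nb y - {x} \<and> card B + dg x = \<Delta> + 1 \<and> (\<Sum>v\<in>B. \<Delta> - dg v) + (\<Delta> - dg y) + 2 \<le> dg x"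
proof -
  obtain N where N: "col x y N" using assms col_exists by (auto simp: nb_def)
  show ?thesis by (intro exI conjI) (rule fan_image[OF N])+
qed

text \<open>In the fan at \<open>x\<close> of colors missing at \<open>y\<close>, the degree
  condition on \<open>u\<close> makes the missing sets of \<open>u\<close>, \<open>x\<close>,
  \<open>y\<close> exceed \<open>\<Delta>\<close> by at least 2 in total. So \<open>u\<close> shares
  two colors with \<open>x\<close> or \<open>y\<close>, and \<open>kierstead\<close> keeps the color
  of \<open>zu\<close> out of both missing sets. \<open>dg y < \<Delta>\<close> provides the two
  colors missing at \<open>y\<close> that it asks for.\<close>

lemma kierstead_set:
  assumes y: "y \<in> nb x"
  shows "\<exists>B. B \<subseteq> nb x - {y} \<and> card B + dg y = \<Delta> + 1 \<and> (\<Sum>z\<in>B. \<Delta> - dg z) + (\<Delta> - dg y) + 2 \<le> dg x \<and>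
    (dg y < \<Delta> \<longrightarrow> (\<forall>z\<in>B. card {u \<in> nb z - {x, y}. dg u + dg x + dg y \<le> 2 * \<Delta>}
        + (\<Delta> - dg z) + (\<Delta> - dg y) + 2 \<le> dg x))"
proof -
  obtain N where N: "col x y N" using y col_exists by (auto simp: nb_def)
  have Nyx: "col y x N" by (rule col_sym[OF N])
  note B = fan_image[OF Nyx]
  let ?B = "(\<lambda>c. N c x) ` Ms N y"
  have "card {u \<in> nb z - {x, y}. dg u + dg x + dg y \<le> 2 * \<Delta>} + (\<Delta> - dg z) + (\<Delta> - dg y) + 2 \<le> dg x"
    if ydeg: "dg y < \<Delta>" and z: "z \<in> ?B" for z
  proof -
    obtain c where c: "c \<in> K" "N c y = y" "N c x = z" using z by (auto simp: Ms_def)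
    have zx: "z \<noteq> x" using col_disj[OF Nyx c(1,2)] c(3) by auto
    have zy: "z \<noteq> y" using col_xy(1)[OF N c(1)] c(3) by blast
    let ?Q = "\<lambda>u. u \<noteq> x \<and> u \<noteq> y \<and> dg u + dg x + dg y \<le> 2 * \<Delta>"
    define H where "H = {k \<in> K. N k z \<noteq> z \<and> ?Q (N k z)}"
    have "{u \<in> nb z. {z, u} \<noteq> {x, y} \<and> ?Q u} = {u \<in> nb z - {x, y}. dg u + dg x + dg y \<le> 2 * \<Delta>}"
      using zx zy by (auto simp: doubleton_eq_iff)
    then have cH: "card H = card {u \<in> nb z - {x, y}. dg u + dg x + dg y \<le> 2 * \<Delta>}"
      unfolding H_def using card_colors[OF N, of z ?Q] by simp
    have H: "k \<notin> Ms N x \<union> Ms N y" if k: "k \<in> H" for k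
    proof
      assume kk: "k \<in> Ms N x \<union> Ms N y"
      define u where "u = N k z"
      have u: "k \<in> K" "N k z = u" "u \<noteq> z" "u \<noteq> x" "u \<noteq> y" "dg u + dg x + dg y \<le> 2 * \<Delta>"
        using k by (auto simp: H_def u_def)
      have kc: "k \<noteq> c" using col_back[OF N, OF c(1,3)] u by auto
      let ?A = "Ms N x \<union> Ms N y"
      have A: "card ?A = card (Ms N x) + card (Ms N y)" using card_Un_disjoint[OF fin_Ms fin_Ms Ms_disj[OF N]] .
      have "card (Ms N u \<union> ?A) + card (Ms N u \<inter> ?A) = card (Ms N u) + card ?A"
        using card_Un_Int[of "Ms N u" ?A] fin_Ms by simp
      moreover have "card (Ms N u \<union> ?A) \<le> \<Delta>"
        using Ms_K[of N] card_mono[OF fin_K, of "Ms N u \<union> ?A"] card_K by auto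
      ultimately have "2 \<le> card (Ms N u \<inter> ?A)"
        using A card_Ms_x[OF N] card_Ms_y[OF N] card_Ms_other[OF N u(4,5)] u(6) by linarith
      then obtain d e where d: "d \<in> Ms N u \<inter> ?A" "e \<in> Ms N u \<inter> ?A" "d \<noteq> e" using two_elements by blast
      have "2 \<le> card (Ms N y)" using card_Ms_y[OF N] ydeg by linarith
      then show False
        using kierstead[OF Nyx, OF c zx u(1) _ kc u(2,3,5,4), of d e] kk d by (auto simp: Ms_def)
    qed
    have z_x: "Ms N z \<inter> (Ms N x \<union> Ms N y) = {}"
      using fan_y[OF Nyx, OF c zx] fan_x[OF Nyx, OF c zx] by (auto simp: Ms_def)
    have "Ms N z \<inter> H = {}" by (auto simp: Ms_def H_def)
    moreover have finH: "finite H" using fin_K by (simp add: H_def)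
    ultimately have "card (H \<union> Ms N z \<union> (Ms N x \<union> Ms N y)) = card H + card (Ms N z) + card (Ms N x \<union> Ms N y)"
      using H z_x fin_Ms[of N] by (subst card_Un_disjoint, auto)+
    moreover have "card (H \<union> Ms N z \<union> (Ms N x \<union> Ms N y)) \<le> \<Delta>"
      using Ms_K[of N] card_mono[OF fin_K, of "H \<union> Ms N z \<union> (Ms N x \<union> Ms N y)"] card_K by (auto simp: H_def)
    moreover have "card (Ms N x \<union> Ms N y) = card (Ms N x) + card (Ms N y)"
      using card_Un_disjoint[OF fin_Ms fin_Ms Ms_disj[OF N]] .
    ultimately show ?thesis
      using cH card_Ms_x[OF N] card_Ms_y[OF N] card_Ms_other[OF N zx zy] dg_le[of x] dg_le[of y] dg_le[of z]
      by linarith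
  qed
  moreover have "(\<Sum>z\<in>?B. \<Delta> - dg z) + (\<Delta> - dg y) + 2 \<le> dg x"
    using B(3) dg_le[of x] dg_le[of y] degree_sum[OF y] by linarith
  ultimately show ?thesis using B(1,2) by (intro exI[of _ ?B]) blast
qed

text \<open>Each of the \<open>\<Delta> + 1 - dg x\<close> colors missing at \<open>x\<close> leads
  from \<open>y\<close> to a candidate. At most \<open>dg x - 1\<close> candidates are adjacent to
  \<open>x\<close>. Another is spoiled only by a color \<open>a\<close> leading from it to a vertex
  with \<open>Q\<close>; such an \<open>a\<close> is one of the \<open>dg x - 1\<close> colors
  present at \<open>x\<close>, and each spoils at most 4 candidates.\<close>

lemma clean_neighbours:
  assumes y: "y \<in> nb x" and m: "3 \<le> m" "\<Delta> + 1 < 5 * m + dg x"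
    and Q: "\<And>u. Q u \<Longrightarrow> dg u + dg x + m \<le> \<Delta> + 1"
  shows "\<Delta> + 6 \<le> card {z \<in> nb y - {x}. \<Delta> + 1 \<le> dg z + dg x \<and> (\<forall>u\<in>nb z. \<not> Q u)} + 6 * dg x"
proof -
  obtain N where N: "col x y N" using y col_exists by (auto simp: nb_def)
  have xy: "x \<noteq> y" by (rule col_neq[OF N])
  have nQy: "\<not> Q y" using Q[of y] degree_sum[OF y] m by auto
  define A where "A = Ms N x"
  have finA: "finite A" using fin_Ms by (simp add: A_def)
  have cA: "card A + dg x = \<Delta> + 1" using card_Ms_x[OF N] by (simp add: A_def)
  have ny: "N c y \<noteq> y" if "c \<in> A" for c using col_disj[OF N, of c] that by (simp add: A_def Ms_def)
  have cK: "c \<in> K" "N c x = x" if "c \<in> A" for c using that by (auto simp: A_def Ms_def)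
  have injA: "inj_on (\<lambda>c. N c y) A" using col_inj[OF N] ny cK(1) by (auto simp: inj_on_def)
  have zx: "N c y \<noteq> x" if "c \<in> A" for c using col_xy(2)[OF N cK(1)[OF that]] .
  have znb: "N c y \<in> nb y" if "c \<in> A" for c
    using col_edge[OF N cK(1)[OF that] ny[OF that]] by (simp add: nb_def)
  have zdeg: "\<Delta> + 1 \<le> dg (N c y) + dg x" if c: "c \<in> A" for c
  proof -
    have "Ms N (N c y) \<subseteq> K - Ms N x"
      using fan_x[OF N, OF cK(1)[OF c] cK(2)[OF c] refl ny[OF c]] Ms_K by (auto simp: Ms_def)
    then have "card (Ms N (N c y)) \<le> card (K - Ms N x)" by (rule card_mono[rotated]) (simp add: fin_K)
    then show ?thesis using card_present[OF N] card_Ms_other[OF N zx[OF c] ny[OF c]] by linarith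
  qed
  define W where "W a = {c \<in> A. N a (N c y) \<noteq> N c y \<and> N a (N c y) \<noteq> x \<and> Q (N a (N c y))}" for a
  define R where "R = {c \<in> A. N c y \<in> nb x}"
  have common: "m \<le> card (Ms N w \<inter> Ms N x - {c})"
    if w: "w \<noteq> x" "Q w" "k \<in> K" "N k x \<noteq> x" "N k w \<noteq> w" for w c k
  proof -
    have "w \<noteq> y" using w nQy by blast
    then have "\<Delta> + 2 \<le> card (Ms N w \<inter> Ms N x) + dg w + dg x"
      using common_missing[OF N w(1) _ w(3,4,5)] by blast
    moreover have "card (Ms N w \<inter> Ms N x) \<le> card (Ms N w \<inter> Ms N x - {c}) + 1"
      using card_Diff_singleton_if[of "Ms N w \<inter> Ms N x" c] by (auto split: if_splits)
    ultimately show ?thesis using Q[OF w(2)] by linarith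
  qed
  \<comment> \<open>For every \<open>g\<close> in \<open>U c\<close>, the vertex
    \<open>N a (N c y)\<close> is the second end of the chain of \<open>x\<close> in the colors
    \<open>a\<close> and \<open>g\<close>. So distinct \<open>c\<close> have disjoint sets
    \<open>U c\<close>, each of size at least \<open>m\<close>, and fewer than \<open>5 * m\<close>
    colors are missing at \<open>x\<close>. \<open>c\<close> is left out of \<open>U c\<close>
    because it has to stay missing at \<open>x\<close>.\<close>
  have W_card: "card (W a) \<le> 4" if a: "a \<in> K - A" for a
  proof -
    have aK: "a \<in> K" "N a x \<noteq> x" using a by (auto simp: A_def Ms_def)
    define U where "U c = Ms N (N a (N c y)) \<inter> Ms N x - {c}" for c
    have big: "m \<le> card (U c)" if c: "c \<in> W a" for c
    proof -
      have "N a (N a (N c y)) \<noteq> N a (N c y)" using c col_inv[OF N aK(1)] by (auto simp: W_def)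
      then show ?thesis using common[of "N a (N c y)" a c] c aK by (auto simp: W_def U_def)
    qed
    have chain: "N a (N c y) \<in> orb (N a) (N g) x" if c: "c \<in> W a" and g: "g \<in> U c" for c g
    proof -
      have cA: "c \<in> A" using c by (simp add: W_def)
      have w: "N a (N c y) \<noteq> N c y" "N a (N c y) \<noteq> x" "N a (N c y) \<noteq> y"
        using c nQy by (auto simp: W_def)
      have finU: "finite (U c)" using fin_Ms by (simp add: U_def)
      have "2 \<le> card (U c - {g})" using big[OF c] m g card_Diff_singleton[of g "U c"] by simp
      then obtain d e where "d \<in> U c - {g}" "e \<in> U c - {g}" "d \<noteq> e" using two_elements by blast
      then show ?thesis
        using distance_two_chain[OF N, OF cK(1)[OF cA] cK(2)[OF cA] refl ny[OF cA] aK refl w, of g d e] g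
        by (auto simp: U_def Ms_def)
    qed
    have dj: "U c \<inter> U c' = {}" if c: "c \<in> W a" "c' \<in> W a" "c \<noteq> c'" for c c'
    proof (rule ccontr)
      assume "U c \<inter> U c' \<noteq> {}"
      then obtain g where g: "g \<in> U c" "g \<in> U c'" by blast
      have "N a (N c y) = N a (N c' y)"
        using distance_two_disjoint[OF N, OF aK _ chain[OF c(1) g(1)] _ chain[OF c(2) g(2)]] c g
        by (auto simp: W_def U_def Ms_def)
      then have "N c y = N c' y" using col_inv[OF N aK(1)] by metis
      then show False using injA c by (auto simp: inj_on_def W_def)
    qed
    have finW: "finite (W a)" using finA by (simp add: W_def)
    have "card (W a) * m \<le> (\<Sum>c\<in>W a. card (U c))"
      using sum_bounded_below[of "W a" m "\<lambda>c. card (U c)"] big by simp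
    also have "\<dots> = card (\<Union>c\<in>W a. U c)"
      using dj finW fin_Ms by (intro card_UN_disjoint[symmetric]) (auto simp: U_def)
    also have "\<dots> \<le> card A" using finA by (intro card_mono) (auto simp: U_def A_def)
    also have "\<dots> < 5 * m" using cA m by linarith
    finally show ?thesis by (metis Suc_eq_plus1 mult_less_cancel2 not_less_eq_eq numeral_eq_Suc pred_numeral_simps(3) semiring_norm(2,8) linorder_not_le less_Suc_eq_le)
  qed
  have R_card: "card R + 1 \<le> dg x"
  proof -
    have "(\<lambda>c. N c y) ` R \<subseteq> nb x - {y}" using ny by (auto simp: R_def)
    then have "card ((\<lambda>c. N c y) ` R) \<le> card (nb x - {y})" using fin_nb by (intro card_mono) auto
    moreover have "card ((\<lambda>c. N c y) ` R) = card R"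
      using injA by (intro card_image) (auto simp: inj_on_def R_def)
    moreover have "card (nb x - {y}) + 1 = dg x"
      using card_Suc_Diff1[OF fin_nb y] by (simp add: dg_def)
    ultimately show ?thesis by linarith
  qed
  define G where "G = {z \<in> nb y - {x}. \<Delta> + 1 \<le> dg z + dg x \<and> (\<forall>u\<in>nb z. \<not> Q u)}"
  have cover: "A \<subseteq> {c \<in> A. N c y \<in> G} \<union> R \<union> (\<Union>a\<in>K - A. W a)"
  proof
    fix c assume c: "c \<in> A"
    show "c \<in> {c \<in> A. N c y \<in> G} \<union> R \<union> (\<Union>a\<in>K - A. W a)"
    proof (cases "N c y \<in> G")
      case False
      then obtain u where u: "u \<in> nb (N c y)" "Q u" using znb[OF c] zx[OF c] zdeg[OF c] by (auto simp: G_def)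
      show ?thesis
      proof (cases "u = x")
        case True then show ?thesis using u c nb_sym by (auto simp: R_def)
      next
        case ux: False
        have uy: "u \<noteq> y" using u nQy by blast
        have ne: "u \<noteq> N c y" using u nb_irrefl by blast
        obtain a where a: "a \<in> K" "N a (N c y) = u"
          using col_ex[OF N, of "N c y" u] u ux uy by (auto simp: nb_def doubleton_eq_iff)
        have "a \<notin> A"
        proof
          assume aA: "a \<in> A"
          have ac: "a \<noteq> c" using a uy col_inv[OF N a(1), of y] by auto
          have "N a u = N c y" by (rule col_back[OF N, OF a])
          have "\<Delta> + 1 \<le> card (Ms N u \<inter> Ms N x) + dg u + dg x" by (rule common_missing_any[OF N ux uy])
          then have "2 \<le> card (Ms N u \<inter> Ms N x)" using Q[OF u(2)] m by linarith
          then obtain d e where "d \<in> Ms N u \<inter> Ms N x" "e \<in> Ms N u \<inter> Ms N x" "d \<noteq> e" using two_elements by blast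
          then show False
            using kierstead_x[OF N, OF cK(1)[OF c] cK(2)[OF c] refl ny[OF c] a(1) cK(2)[OF aA] ac a(2) ne ux uy, of d e]
            by (auto simp: Ms_def)
        qed
        then show ?thesis using a c u ux ne by (auto simp: W_def)
      qed
    qed (use c in simp)
  qed
  have finW: "finite (W a)" for a using finA by (simp add: W_def)
  have "card A \<le> card ({c \<in> A. N c y \<in> G} \<union> R \<union> (\<Union>a\<in>K - A. W a))"
    using cover finA finW fin_K by (intro card_mono) (auto simp: R_def)
  also have "\<dots> \<le> card ({c \<in> A. N c y \<in> G} \<union> R) + card (\<Union>a\<in>K - A. W a)" by (rule card_Un_le)
  also have "\<dots> \<le> card {c \<in> A. N c y \<in> G} + card R + card (\<Union>a\<in>K - A. W a)"
    using card_Un_le[of "{c \<in> A. N c y \<in> G}" R] by simp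
  also have "card (\<Union>a\<in>K - A. W a) \<le> (\<Sum>a\<in>K - A. card (W a))" using fin_K by (intro card_UN_le) simp
  also have "\<dots> \<le> card (K - A) * 4" using sum_bounded_above[of "K - A" "\<lambda>a. card (W a)" 4] W_card by simp
  finally have 1: "card A \<le> card {c \<in> A. N c y \<in> G} + card R + card (K - A) * 4" by simp
  have "card {c \<in> A. N c y \<in> G} = card ((\<lambda>c. N c y) ` {c \<in> A. N c y \<in> G})"
    using injA by (intro card_image[symmetric]) (auto simp: inj_on_def)
  also have "\<dots> \<le> card G" using fin_nb by (intro card_mono) (auto simp: G_def)
  finally have "card {c \<in> A. N c y \<in> G} \<le> card G" .
  then show ?thesis using 1 R_card card_present[OF N] cA unfolding G_def[symmetric] A_def by linarith
qed

end

subsection \<open>Elementary inequalities\<close>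

lemma sum_split_ge:
  fixes f g :: "'a \<Rightarrow> real"
  assumes "finite X" "B \<subseteq> X" "\<And>z. z \<in> B \<Longrightarrow> g z \<le> f z" "\<And>y. y \<in> X \<Longrightarrow> c \<le> f y"
  shows "sum g B + (real (card X) - real (card B)) * c \<le> sum f X"
proof -
  have fB: "finite B" using assms finite_subset by blast
  have "sum f X = sum f B + sum f (X - B)" using sum.subset_diff[OF assms(2,1)] by (simp add: add.commute)
  moreover have "sum g B \<le> sum f B" by (rule sum_mono) (rule assms(3))
  moreover have "real (card (X - B)) * c \<le> sum f (X - B)"
    using sum_bounded_below[of "X - B" c f] assms(4) by simp
  moreover have "real (card (X - B)) = real (card X) - real (card B)"
    using card_Diff_subset[OF fB assms(2)] card_mono[OF assms(1,2)] by (simp add: of_nat_diff)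
  ultimately show ?thesis by simp
qed

lemma add_inverse_ge_2:
  fixes a c :: real assumes "0 < a" "0 < c" shows "2 \<le> a / c + c / a"
proof -
  have "0 \<le> (a - c)\<^sup>2 / (a * c)" using assms by simp
  also have "\<dots> = a / c + c / a - 2" using assms by (simp add: field_simps power2_eq_square)
  finally show ?thesis by simp
qed

text \<open>Let \<open>s\<close> be the largest value and \<open>d = card X\<close>. If
  \<open>2 * s \<le> d\<close>, terms of size at least \<open>1 / s\<close> suffice. Otherwise at
  least \<open>s\<close> elements have value at most \<open>d - s\<close>, and the sum is at least
  \<open>s / (d - s) + (d - s) / s\<close>.\<close>

lemma sum_reciprocal_ge_2:
  fixes t :: "'a \<Rightarrow> nat"
  assumes X: "finite X" "X \<noteq> {}" and pos: "\<And>y. y \<in> X \<Longrightarrow> 1 \<le> t y"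
    and t: "\<And>y. y \<in> X \<Longrightarrow> t y \<le> card {z \<in> X - {y}. t y + t z \<le> card X}"
  shows "2 \<le> (\<Sum>y\<in>X. 1 / real (t y))"
proof -
  obtain y where y: "y \<in> X" "t y = Max (t ` X)"
    using Max_in[of "t ` X"] X by (metis (no_types, lifting) finite_imageI imageE image_is_empty)
  define s where "s = t y"
  have le: "t z \<le> s" if "z \<in> X" for z using that y X by (simp add: s_def)
  define Z where "Z = {z \<in> X - {y}. s + t z \<le> card X}"
  have Z: "Z \<subseteq> X" "s \<le> card Z" using t[OF y(1)] by (auto simp: Z_def s_def)
  have s1: "1 \<le> s" unfolding s_def by (rule pos[OF y(1)])
  then have "card Z > 0" using Z by linarith
  then obtain z where "z \<in> Z" by (auto simp: card_gt_0_iff)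
  then have sd: "s + 1 \<le> card X" using pos[of z] by (auto simp: Z_def)
  define d where "d = real (card X)"
  have sr: "1 \<le> real s" "real s + 1 \<le> d" using s1 sd unfolding d_def by linarith+
  have rec: "1 / real s \<le> 1 / real (t z)" if "z \<in> X" for z
  proof -
    have "0 < real (t z)" "real (t z) \<le> real s" using pos[OF that] le[OF that] by simp_all
    then show ?thesis by (simp add: frac_le)
  qed
  show ?thesis
  proof (cases "2 * s \<le> card X")
    case True
    have "real (card X) * (1 / real s) \<le> (\<Sum>y\<in>X. 1 / real (t y))"
      by (rule sum_bounded_below) (rule rec)
    moreover have "2 \<le> real (card X) * (1 / real s)" using True s1 by (simp add: field_simps)
    ultimately show ?thesis by linarith
  next
    case False
    then have sd2: "d - s < s" unfolding d_def by linarith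
    have "(\<Sum>z\<in>Z. 1 / (d - s)) + (real (card X) - real (card Z)) * (1 / s) \<le> (\<Sum>y\<in>X. 1 / real (t y))"
    proof (rule sum_split_ge[OF X(1) Z(1)])
      show "1 / (d - s) \<le> 1 / real (t z)" if "z \<in> Z" for z
      proof -
        have "real (t z) \<le> d - s" "0 < real (t z)" using that pos[of z] unfolding Z_def d_def by auto
        then show ?thesis by (simp add: frac_le)
      qed
      show "1 / real s \<le> 1 / real (t z)" if "z \<in> X" for z
        by (rule rec[OF that])
    qed
    moreover have "real s / (d - s) + (d - s) / s
      \<le> (\<Sum>z\<in>Z. 1 / (d - s)) + (real (card X) - real (card Z)) * (1 / s)"
    proof -
      have "0 \<le> (real (card Z) - s) * (1 / (d - s) - 1 / s)"
        using Z sd2 sr by (intro mult_nonneg_nonneg) (auto simp: frac_le)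
      then show ?thesis by (simp add: algebra_simps d_def diff_divide_distrib)
    qed
    moreover have "2 \<le> real s / (d - s) + (d - s) / s" using sr by (intro add_inverse_ge_2) auto
    ultimately show ?thesis by linarith
  qed
qed

lemma ratio_shift:
  fixes a t e :: real assumes "0 \<le> e" "e < t" "t \<le> a"
  shows "a / t \<le> (a - e) / (t - e)"
proof -
  have "0 \<le> e * (a - t)" using assms by simp
  then have "a * (t - e) \<le> (a - e) * t" by (simp add: algebra_simps)
  then show ?thesis using assms by (simp add: frac_le_eq divide_le_eq le_divide_eq field_simps)
qed

lemma ratio_shift_down:
  fixes a t e f :: real assumes "0 \<le> e" "e \<le> f" "f < t" "a \<le> t"
  shows "(a - f) / (t - f) \<le> (a - e) / (t - e)"
proof -
  have "0 \<le> (f - e) * (t - a)" using assms by simp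
  then have "(a - f) * (t - e) \<le> (a - e) * (t - f)" by (simp add: algebra_simps)
  then show ?thesis using assms by (simp add: divide_le_eq le_divide_eq field_simps)
qed

text \<open>As a function of \<open>e\<close> the right side is concave because
  \<open>a \<le> t\<close>, so between 0 and \<open>f\<close> it lies above its chord, which is the
  left side.\<close>

lemma ratio_chord:
  fixes a t e f :: real assumes "0 \<le> e" "e \<le> f" "f < t" "a \<le> t" "0 < a"
  shows "a / t - e * ((t - a) / (t * (t - f))) \<le> (a - e) / (t - e)"
proof -
  have "(a - e) / (t - e) - a / t = - (e * (t - a) / (t * (t - e)))"
    using assms by (simp add: field_simps)
  moreover have "e * (t - a) / (t * (t - e)) \<le> e * (t - a) / (t * (t - f))"
    using assms by (intro divide_left_mono mult_left_mono mult_pos_pos mult_nonneg_nonneg) auto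
  ultimately show ?thesis by simp
qed

section \<open>The discharging rule and the number of small neighbours\<close>

locale discharging = critical_graph V E \<Delta> for V :: "'a set" and E \<Delta> +
  fixes q b :: real
  assumes b_def: "b = real \<Delta> - q" and b17: "17 \<le> b" and q_lo: "2 * b \<le> q" and q_hi: "q \<le> 1407 / 625 * b"
begin

text \<open>Vertices with \<open>small v\<close> need charge. The light ones among them, of degree at least \<open>q - 19/50 b\<close>,
  receive at a fixed rate, and the heavy ones share what is left. The threshold is low enough for
  light vertices to live on the fixed rate, and high enough for heavy vertices to be low, in the
  sense of \<open>low_count_le_card\<close>, with respect to all \<open>x\<close> with \<open>d(x) \<le> 69/50 b + 1\<close>. Larger heavy \<open>x\<close>
  are served by Kierstead paths alone. The factor \<open>1407/625 = 2.2512\<close> is \<open>0.69241 / (1 - 0.69241)\<close> rounded up.\<close>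

definition small :: "'a \<Rightarrow> bool" where "small v \<longleftrightarrow> real (dg v) < q"
definition heavy :: "'a \<Rightarrow> bool" where "heavy v \<longleftrightarrow> real (dg v) < q - 19 / 50 * b"
definition nS :: "'a \<Rightarrow> nat" where "nS y = card {u \<in> nb y. small u}"
definition nH :: "'a \<Rightarrow> nat" where "nH y = card {u \<in> nb y. heavy u}"
definition nL :: "'a \<Rightarrow> nat" where "nL y = card {u \<in> nb y. small u \<and> \<not> heavy u}"
definition free :: "'a \<Rightarrow> bool" where "free z \<longleftrightarrow> \<not> small z \<and> (\<forall>u\<in>nb z. \<not> small u)"
definition e :: "'a \<Rightarrow> real" where "e y = real \<Delta> - real (dg y)"
definition gain :: "'a \<Rightarrow> real" where
  "gain y = (\<Sum>z\<in>{z \<in> nb y. free z}. (real (dg z) - q) / real (dg z))"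

text \<open>A free vertex has no small neighbour to serve and hands its surplus evenly to all
  neighbours; \<open>gain\<close> is what reaches a vertex this way, and it is passed on to heavy
  neighbours only. The light rate scales with the surplus \<open>b - e z\<close>. Given at most
  \<open>5 / 2 * b\<close> small neighbours by \<open>nS_le\<close>, 2/5 is the largest factor for
  which this bound rules out overspending.\<close>

definition transfer :: "'a \<Rightarrow> 'a \<Rightarrow> real" where
  "transfer z y =
    (if small z then 0
     else if free z then (real (dg z) - q) / real (dg z)
     else if heavy y then (b - e z + gain z - 2 / 5 * (b - e z) / b * nL z) / nH z
     else if small y then 2 / 5 * (b - e z) / b
     else 0)"

lemma heavy_small: "heavy v \<Longrightarrow> small v"
  using b17 by (simp add: heavy_def small_def)

lemma nS_split: "nS y = nH y + nL y"
proof -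
  have "{u \<in> nb y. small u} = {u \<in> nb y. heavy u} \<union> {u \<in> nb y. small u \<and> \<not> heavy u}"
    using heavy_small by auto
  then show ?thesis unfolding nS_def nH_def nL_def
    using fin_nb[of y] by (simp add: card_Un_disjoint disjoint_iff)
qed

lemma dg_q: "real (dg v) - q = b - e v"
  by (simp add: b_def e_def)

lemma e_nonneg: "0 \<le> e v" and e_nat: "e v = real (\<Delta> - dg v)"
  using dg_le[of v] by (auto simp: e_def of_nat_diff)

lemma small_e: "small v \<longleftrightarrow> b < e v"
  by (auto simp: small_def e_def b_def)

lemma gain_nonneg: "0 \<le> gain y"
  unfolding gain_def by (intro sum_nonneg) (auto simp: free_def small_def)

lemma nS_pos: "u \<in> nb y \<Longrightarrow> small u \<Longrightarrow> 1 \<le> nS y"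
  and nH_pos: "u \<in> nb y \<Longrightarrow> heavy u \<Longrightarrow> 1 \<le> nH y"
proof -
  assume u: "u \<in> nb y"
  show "1 \<le> nS y" if "small u"
  proof -
    have "{u \<in> nb y. small u} \<noteq> {}" using u that by blast
    then show ?thesis using fin_nb[of y] by (simp add: nS_def Suc_le_eq card_gt_0_iff)
  qed
  show "1 \<le> nH y" if "heavy u"
  proof -
    have "{u \<in> nb y. heavy u} \<noteq> {}" using u that by blast
    then show ?thesis using fin_nb[of y] by (simp add: nH_def Suc_le_eq card_gt_0_iff)
  qed
qed

text \<open>The witness is the number of small vertices in the fan. Each has deficit above
  \<open>b\<close>, while the total deficit is bounded; the remaining small neighbours of
  \<open>y\<close> are \<open>x\<close> and vertices outside the fan.\<close>

lemma nS_bound: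
  assumes x: "small x" and y: "y \<in> nb x"
  shows "\<exists>k::nat. real (nS y) + e y + 1 \<le> real (dg x) + k \<and> k * b + e y + 2 \<le> real (dg x)"
proof -
  obtain B where B: "B \<subseteq> nb y - {x}" "card B + dg x = \<Delta> + 1"
      "(\<Sum>v\<in>B. \<Delta> - dg v) + (\<Delta> - dg y) + 2 \<le> dg x" using fan_set[OF y] by blast
  define k where "k = card {v \<in> B. small v}"
  have finB: "finite B" using B fin_nb finite_subset by (metis finite_Diff)
  have "real k * b \<le> (\<Sum>v\<in>{v \<in> B. small v}. e v)"
    using sum_bounded_below[of "{v \<in> B. small v}" b e] small_e by (auto simp: k_def less_imp_le)
  also have "\<dots> \<le> (\<Sum>v\<in>B. e v)" using finB e_nonneg by (intro sum_mono2) auto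
  also have "\<dots> = real (\<Sum>v\<in>B. \<Delta> - dg v)" by (simp add: e_nat)
  finally have 1: "k * b + e y + 2 \<le> real (dg x)" using B(3) unfolding e_nat by linarith
  have "{u \<in> nb y. small u} \<subseteq> insert x ({v \<in> B. small v} \<union> (nb y - {x} - B))" by blast
  then have "nS y \<le> card (insert x ({v \<in> B. small v} \<union> (nb y - {x} - B)))"
    unfolding nS_def using finB fin_nb by (intro card_mono) auto
  also have "\<dots> \<le> 1 + (k + card (nb y - {x} - B))"
    using card_insert_le_m1 card_Un_le[of "{v \<in> B. small v}" "nb y - {x} - B"] finB fin_nb[of y]
    by (simp add: card_insert_if k_def)
  also have "card (nb y - {x} - B) = card (nb y - {x}) - card B"
    using finB B(1) by (rule card_Diff_subset)
  finally have 2: "nS y \<le> 1 + (k + (card (nb y - {x}) - card B))" .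
  have "card B \<le> card (nb y - {x})" using B(1) fin_nb by (intro card_mono) auto
  moreover have "card (nb y - {x}) + 1 = dg y"
    using card_Suc_Diff1[OF fin_nb, of x y] y nb_sym by (simp add: dg_def)
  ultimately have "real (nS y) + e y + 1 \<le> real (dg x) + k"
    using 2 B(2) dg_le[of y] unfolding e_nat by linarith
  with 1 show ?thesis by blast
qed

lemma nS_le: "real (nS y) \<le> 5 / 2 * b"
proof (cases "nS y = 0")
  case False
  then have "card {u \<in> nb y. small u} > 0" by (simp add: nS_def)
  then obtain x where x: "x \<in> nb y" "small x" by (auto simp: card_gt_0_iff)
  obtain k :: nat where k: "real (nS y) + e y + 1 \<le> real (dg x) + k" "k * b + e y + 2 \<le> real (dg x)"
    using nS_bound[OF x(2)] x(1) nb_sym by blast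
  have d: "real (dg x) < 1407 / 625 * b" using x q_hi by (simp add: small_def)
  have "k * b < 3 * b" using k(2) d e_nonneg[of y] b17 by linarith
  then have "real k < 3" using b17 by simp
  then have "k \<le> 2" by simp
  then show ?thesis using k(1) d e_nonneg[of y] b17 by linarith
qed (use b17 in simp)

lemma nL_le: "2 / 5 * real (nL y) \<le> b"
  using nS_le[of y] nS_split[of y] by linarith

lemma transfer_heavy:
  assumes "heavy x" "x \<in> nb y" "\<not> small y"
  shows "transfer y x = ((b - e y) * (b - 2 / 5 * nL y) / b + gain y) / nH y"
  using assms heavy_small b17 by (auto simp: transfer_def free_def field_simps)

text \<open>By \<open>nS_le\<close> a light neighbour takes at most \<open>(b - e y) / nS y\<close>,
  so the heavy ones never get less than in an even split; this is the second bound.\<close>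

lemma transfer_heavy_ge:
  assumes "heavy x" "x \<in> nb y" "\<not> small y"
  shows "(b - e y) * (b - 2 / 5 * nL y) / (b * nH y) \<le> transfer y x"
    and "(b - e y + gain y) / nS y \<le> transfer y x"
proof -
  have h: "1 \<le> nH y" by (rule nH_pos[OF assms(2,1)])
  have n: "real (nS y) = nH y + nL y" using nS_split by simp
  have be: "0 \<le> b - e y" using assms small_e by simp
  show "(b - e y) * (b - 2 / 5 * nL y) / (b * nH y) \<le> transfer y x"
    unfolding transfer_heavy[OF assms] using h gain_nonneg[of y] by (simp add: add_divide_distrib)
  have "b * nH y \<le> (b - 2 / 5 * nL y) * nS y"
  proof -
    have "0 \<le> real (nL y) * (b - 2 / 5 * nS y)" using nS_le[of y] by (intro mult_nonneg_nonneg) auto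
    then show ?thesis by (simp add: n algebra_simps)
  qed
  then have "1 / nS y \<le> (b - 2 / 5 * nL y) / (b * nH y)" using h n b17 by (simp add: field_simps)
  then have "(b - e y) * (1 / nS y) \<le> (b - e y) * ((b - 2 / 5 * nL y) / (b * nH y))"
    using be by (rule mult_left_mono)
  moreover have "gain y / nS y \<le> gain y / nH y"
    using h n gain_nonneg[of y] by (intro divide_left_mono) auto
  ultimately show "(b - e y + gain y) / nS y \<le> transfer y x"
    unfolding transfer_heavy[OF assms] by (simp add: add_divide_distrib)
qed

lemma transfer_nonneg: "0 \<le> transfer z y" if "y \<in> nb z"
proof -
  have "0 \<le> b - e z" if "\<not> small z" using that small_e by simp
  then show ?thesis
    using transfer_heavy[of y z] that nL_le[of z] gain_nonneg[of z] b17 dg_q[of z]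
    by (cases "heavy y \<and> \<not> small z") (auto simp: transfer_def free_def dest: heavy_small)
qed

lemma transfer_light:
  assumes "small x" "\<not> heavy x" "x \<in> nb y"
  shows "2 / 5 * (1 - e y / b) \<le> transfer y x"
  using assms b17 small_e[of y] by (auto simp: transfer_def free_def field_simps)

subsection \<open>The charge received by small vertices\<close>

lemma max_deficit:
  assumes "nb x \<noteq> {}"
  obtains y where "y \<in> nb x" "\<And>z. z \<in> nb x \<Longrightarrow> e z \<le> e y"
proof -
  have "Max (e ` nb x) \<in> e ` nb x" using assms fin_nb by (intro Max_in) auto
  then obtain y where "y \<in> nb x" "e y = Max (e ` nb x)" by (metis imageE)
  then show ?thesis using that fin_nb by (metis Max_ge finite_imageI image_eqI)
qed

text \<open>For a neighbour of maximum deficit \<open>m\<close>, the set \<open>B\<close> has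
  \<open>m + 1\<close> members of bounded total deficit, and all other deficits are at most
  \<open>m\<close>. The rate 2/5 is thus applied to at least \<open>19 / 20 * b\<close>, which
  matches the \<open>19 / 50\<close> in \<open>heavy\<close>.\<close>

lemma receive_light:
  assumes x: "small x" "\<not> heavy x"
  shows "q - dg x \<le> (\<Sum>y\<in>nb x. transfer y x)"
proof -
  define d where "d = real (dg x)"
  have d: "q - 19 / 50 * b \<le> d" "d < q" using x by (auto simp: small_def heavy_def d_def)
  have "0 < d" using d q_lo b17 by linarith
  then have ne: "nb x \<noteq> {}" by (auto simp: d_def dg_def)
  obtain y where y: "y \<in> nb x" "\<And>z. z \<in> nb x \<Longrightarrow> e z \<le> e y" by (rule max_deficit[OF ne]) blast
  obtain B where B: "B \<subseteq> nb x - {y}" "card B + dg y = \<Delta> + 1"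
    "(\<Sum>z\<in>B. \<Delta> - dg z) + (\<Delta> - dg y) + 2 \<le> dg x"
    using kierstead_set[OF y(1)] by blast
  define m where "m = e y"
  have cB: "real (card B) = m + 1" using B(2) dg_le[of y] unfolding m_def e_nat by linarith
  have "real (\<Sum>z\<in>B. \<Delta> - dg z) = (\<Sum>z\<in>B. e z)" by (simp add: e_nat)
  then have sB: "(\<Sum>z\<in>B. e z) + m + 2 \<le> d" using B(3) unfolding m_def e_nat[of y] d_def by linarith
  have cX: "real (card (nb x)) = d" by (simp add: d_def dg_def)
  have low: "2 / 5 * (1 - e z / b) \<le> transfer z x" if "z \<in> nb x" for z
    using transfer_light[OF x] that nb_sym by blast
  have gB: "(\<Sum>z\<in>B. 2 / 5 * (1 - e z / b)) = 2 / 5 * ((m + 1) - (\<Sum>z\<in>B. e z) / b)"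
    by (simp add: sum_distrib_left[symmetric] sum_subtractf sum_divide_distrib[symmetric] cB)
  have gB': "2 / 5 * ((m + 1) - (d - m - 2) / b) \<le> (\<Sum>z\<in>B. 2 / 5 * (1 - e z / b))"
    unfolding gB using sB b17 by (simp add: divide_right_mono)
  define c where "c = (if m \<le> b then 2 / 5 * (1 - m / b) else 0)"
  have "(\<Sum>z\<in>B. 2 / 5 * (1 - e z / b)) + (real (card (nb x)) - real (card B)) * c \<le> (\<Sum>y\<in>nb x. transfer y x)"
  proof (rule sum_split_ge[OF fin_nb])
    show "B \<subseteq> nb x" using B(1) by blast
    show "2 / 5 * (1 - e z / b) \<le> transfer z x" if "z \<in> B" for z using low that B(1) by blast
    show "c \<le> transfer z x" if z: "z \<in> nb x" for z
    proof (cases "m \<le> b")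
      case True
      have "e z / b \<le> m / b" using y(2)[OF z] b17 by (simp add: m_def divide_right_mono)
      then show ?thesis using low[OF z] True by (simp add: c_def)
    next
      case False then show ?thesis using transfer_nonneg[of x z] z nb_sym by (simp add: c_def)
    qed
  qed
  then have S: "2 / 5 * ((m + 1) - (d - m - 2) / b) + (d - (m + 1)) * c \<le> (\<Sum>y\<in>nb x. transfer y x)"
    using gB' unfolding cB cX by linarith
  have "q - d \<le> 19 / 50 * b" using d by simp
  also have "19 / 50 * b \<le> 2 / 5 * ((m + 1) - (d - m - 2) / b) + (d - (m + 1)) * c"
  proof (cases "m \<le> b")
    case True
    have "19 / 20 * b * b \<le> ((m + 1) * b - (d - m - 2)) + (d - (m + 1)) * (b - m)"
    proof -
      \<comment> \<open>Completing the square in \<open>m + 1\<close>: the worst case is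
        \<open>m + 1 = d / 2\<close>. The remaining \<open>d * b - d\<^sup>2 / 4\<close> equals
        \<open>24 / 25 * b * b\<close> at \<open>8 / 5 * b\<close> and at \<open>12 / 5 * b\<close>
        and is larger in between.\<close>
      have "0 \<le> ((m + 1) - d / 2)\<^sup>2" by simp
      then have 1: "d * b - d\<^sup>2 / 4 \<le> ((m + 1) * b - (d - m - 2)) + (d - (m + 1)) * (b - m)"
        by (simp add: power2_eq_square algebra_simps)
      have "8 / 5 * b \<le> d" "d \<le> 12 / 5 * b" using d q_lo q_hi b17 by linarith+
      then have "0 \<le> (d - 8 / 5 * b) * (12 / 5 * b - d)" by (intro mult_nonneg_nonneg) auto
      then have 2: "96 / 25 * (b * b) \<le> 4 * (d * b) - d * d" by (simp add: algebra_simps)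
      have "0 \<le> b * b" by simp
      then show ?thesis using 1 2 unfolding power2_eq_square mult.assoc[of _ b b] by linarith
    qed
    then have "19 / 20 * b * b / b \<le> (((m + 1) * b - (d - m - 2)) + (d - (m + 1)) * (b - m)) / b"
      using b17 by (intro divide_right_mono) auto
    moreover have "19 / 20 * b * b / b = 19 / 20 * b" using b17 by simp
    moreover have "(((m + 1) * b - (d - m - 2)) + (d - (m + 1)) * (b - m)) / b
      = (m + 1) - (d - m - 2) / b + (d - (m + 1)) * (1 - m / b)"
    proof -
      have "(b - m) / b = 1 - m / b" using b17 by (simp add: diff_divide_distrib)
      then have "(d - (m + 1)) * (b - m) / b = (d - (m + 1)) * (1 - m / b)"
        by (metis times_divide_eq_right)
      moreover have "((m + 1) * b - (d - m - 2)) / b = (m + 1) - (d - m - 2) / b"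
        using b17 by (simp add: diff_divide_distrib)
      ultimately show ?thesis by (simp only: add_divide_distrib)
    qed
    ultimately have *: "19 / 20 * b \<le> (m + 1) - (d - m - 2) / b + (d - (m + 1)) * (1 - m / b)" by linarith
    have "(d - (m + 1)) * c = 2 / 5 * ((d - (m + 1)) * (1 - m / b))" using True by (simp add: c_def)
    then show ?thesis using * by argo
  next
    case False
    have "d - m - 2 \<le> 782 / 625 * b" using False d q_hi by linarith
    then have "(d - m - 2) / b \<le> 782 / 625" using b17 by (simp add: divide_le_eq)
    moreover have "(d - (m + 1)) * c = 0" using False by (simp add: c_def)
    ultimately show ?thesis using False b17 by argo
  qed
  finally show ?thesis using S by (simp add: d_def)
qed

lemma low_count_eq:
  assumes "P x" "y \<in> nb x"
  shows "low_count P x y = card {u \<in> nb y. P u} + (\<Delta> - dg y)"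
proof -
  have "{u \<in> nb y - {x}. P u} = {u \<in> nb y. P u} - {x}" by blast
  moreover have "x \<in> {u \<in> nb y. P u}" using assms nb_sym by blast
  ultimately show ?thesis
    using card_Suc_Diff1[of "{u \<in> nb y. P u}" x] fin_nb[of y] by (simp add: low_count_def)
qed

lemma low_count_less:
  assumes "y \<in> nb x" "\<And>u. P u \<Longrightarrow> dg u + dg x \<le> \<Delta>"
  shows "low_count P x y + 1 \<le> dg x"
proof -
  have "low_count P x y \<le> card {z \<in> nb x - {y}. low_count P x y + low_count P x z \<le> dg x}"
    using low_count_le_card[of y x P] assms by blast
  also have "\<dots> \<le> card (nb x - {y})" using fin_nb by (intro card_mono) auto
  finally show ?thesis using card_Suc_Diff1[OF fin_nb assms(1)] by (simp add: dg_def)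
qed

lemma sum_low_count:
  assumes "nb x \<noteq> {}" "\<And>u. P u \<Longrightarrow> dg u + dg x \<le> \<Delta>"
  shows "2 \<le> (\<Sum>y\<in>nb x. 1 / real (low_count P x y))"
proof (rule sum_reciprocal_ge_2[OF fin_nb assms(1)])
  show "1 \<le> low_count P x y" for y by (simp add: low_count_def)
  show "low_count P x y \<le> card {z \<in> nb x - {y}. low_count P x y + low_count P x z \<le> card (nb x)}"
    if "y \<in> nb x" for y using low_count_le_card[OF that] assms(2) by (simp add: dg_def)
qed

text \<open>Here every small vertex is low for \<open>x\<close>, and the low count is
  \<open>t = nS y + e y\<close>, at most \<open>b\<close>. Taking the deficit off both
  \<open>b + G\<close> and \<open>t\<close> can only raise their ratio, so \<open>y\<close> sends at
  least \<open>(b + G) / t\<close>, and \<open>sum_low_count\<close> gives the factor 2.\<close>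

lemma receive_short:
  assumes x: "nb x \<noteq> {}" "real (dg x) \<le> b + 1"
    and G: "0 \<le> G" "\<And>y. y \<in> nb x \<Longrightarrow> G \<le> gain y"
  shows "2 * (b + G) \<le> (\<Sum>y\<in>nb x. transfer y x)"
proof -
  have hx: "heavy x" using x q_lo b17 by (simp add: heavy_def)
  have P: "dg u + dg x \<le> \<Delta>" if "small u" for u
  proof -
    have "real (dg u) + real (dg x) < real \<Delta> + 1" using that x(2) by (simp add: small_def b_def)
    then show ?thesis by linarith
  qed
  have "(b + G) * (1 / real (low_count small x y)) \<le> transfer y x" if y: "y \<in> nb x" for y
  proof -
    define t where "t = real (low_count small x y)"
    have t: "t = nS y + e y" unfolding t_def low_count_eq[of small, OF heavy_small[OF hx] y] by (simp add: nS_def e_nat)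
    have t1: "t + 1 \<le> dg x" using low_count_less[OF y, of small] P by (simp add: t_def)
    have yx: "x \<in> nb y" using y nb_sym by blast
    have n1: "1 \<le> nS y" by (rule nS_pos[OF yx heavy_small[OF hx]])
    have ns: "\<not> small y" using t t1 x(2) n1 small_e[of y] by linarith
    have "(b + G) / t \<le> (b + G - e y) / (t - e y)"
      using t t1 x(2) n1 G(1) e_nonneg[of y] by (intro ratio_shift) linarith+
    also have "\<dots> = (b + G - e y) / nS y" by (simp add: t)
    also have "\<dots> \<le> (b - e y + gain y) / nS y" using G(2)[OF y] by (intro divide_right_mono) auto
    also have "\<dots> \<le> transfer y x" by (rule transfer_heavy_ge(2)[OF hx yx ns])
    finally show ?thesis by (simp add: t_def)
  qed
  then have "(\<Sum>y\<in>nb x. (b + G) * (1 / real (low_count small x y))) \<le> (\<Sum>y\<in>nb x. transfer y x)"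
    by (rule sum_mono)
  moreover have "(b + G) * 2 \<le> (b + G) * (\<Sum>y\<in>nb x. 1 / real (low_count small x y))"
    using sum_low_count[OF x(1), of small] P G(1) b17 by (intro mult_left_mono) auto
  ultimately show ?thesis unfolding sum_distrib_left[symmetric] by linarith
qed

text \<open>\<open>157 / 625\<close> is \<open>1407 / 625 - 2\<close>, the range of
  \<open>dg x\<close> that \<open>2 * b\<close> does not cover, and \<open>13 / 100\<close> is
  slightly more than half of it. \<open>clean_neighbours\<close> supplies at least
  \<open>2 / 5 * \<Delta>\<close> free donors.\<close>

lemma gain_ge:
  assumes y: "y \<in> nb x" and d: "real (dg x) \<le> 157 / 625 * b"
  shows "13 / 100 * b \<le> gain y"
proof -
  define m where "m = nat \<lfloor>b - dg x + 1\<rfloor>"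
  have m: "real m \<le> b - dg x + 1" "b - dg x < real m"
    using d b17 unfolding m_def by linarith+
  define Z where "Z = {z \<in> nb y - {x}. \<Delta> + 1 \<le> dg z + dg x \<and> (\<forall>u\<in>nb z. \<not> small u)}"
  have D: "real \<Delta> \<le> 2032 / 625 * b" "3 * b \<le> real \<Delta>" using q_hi q_lo by (auto simp: b_def)
  have "\<Delta> + 6 \<le> card Z + 6 * dg x"
    unfolding Z_def
  proof (rule clean_neighbours[OF y])
    have "2 < real m" using m d b17 by linarith
    then show "3 \<le> m" by linarith
    have "real \<Delta> + 1 < 5 * real m + dg x" using m D d b17 by linarith
    then show "\<Delta> + 1 < 5 * m + dg x" by linarith
    show "dg u + dg x + m \<le> \<Delta> + 1" if "small u" for u
    proof -
      have "real (dg u) + dg x + m < real \<Delta> + 1" using that m by (simp add: small_def b_def)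
      then show ?thesis by linarith
    qed
  qed
  then have cZ: "real \<Delta> - 6 * dg x \<le> card Z" by linarith
  have val: "free z \<and> (b - dg x) / \<Delta> \<le> (real (dg z) - q) / dg z" if z: "z \<in> Z" for z
  proof -
    have dz: "real \<Delta> + 1 \<le> dg z + dg x" using z by (simp add: Z_def flip: of_nat_Suc of_nat_add)
    have pos: "0 < b - dg x" using d b17 by linarith
    have ge: "b - dg x \<le> real (dg z) - q" using dz by (simp add: b_def)
    have "0 < real (dg z)" using ge pos q_lo b17 by linarith
    then have "(b - dg x) / \<Delta> \<le> (real (dg z) - q) / dg z"
      using ge pos dg_le[of z] by (intro frac_le) auto
    moreover have "\<not> small z" using ge pos by (simp add: small_def)
    ultimately show ?thesis using z by (auto simp: free_def Z_def)
  qed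
  have finZ: "finite Z" using fin_nb by (simp add: Z_def)
  have "13 / 100 * b * \<Delta> \<le> (real \<Delta> - 6 * dg x) * (b - dg x)"
  proof -
    have "2 / 5 * real \<Delta> \<le> real \<Delta> - 6 * dg x" using D d b17 by linarith
    moreover have "7 / 10 * b \<le> b - dg x" using d b17 by linarith
    ultimately have "(2 / 5 * real \<Delta>) * (7 / 10 * b) \<le> (real \<Delta> - 6 * dg x) * (b - dg x)"
      using b17 by (intro mult_mono) auto
    moreover have "0 \<le> real \<Delta> * b" using b17 by simp
    ultimately show ?thesis by (simp add: algebra_simps)
  qed
  also have "\<dots> \<le> card Z * (b - dg x)" using cZ d b17 by (intro mult_right_mono) auto
  finally have "13 / 100 * b \<le> card Z * ((b - dg x) / \<Delta>)" using D b17 by (simp add: field_simps)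
  also have "\<dots> \<le> (\<Sum>z\<in>Z. (real (dg z) - q) / dg z)"
    using sum_bounded_below[of Z "(b - dg x) / \<Delta>"] val by simp
  also have "\<dots> \<le> gain y"
    unfolding gain_def using fin_nb val
    by (intro sum_mono2) (auto simp: Z_def free_def small_def)
  finally show ?thesis .
qed

lemma receive_low:
  assumes x: "nb x \<noteq> {}" "real (dg x) \<le> b + 1"
  shows "q - dg x \<le> (\<Sum>y\<in>nb x. transfer y x)"
proof (cases "q - 2 * b \<le> dg x")
  case True
  then show ?thesis using receive_short[OF x, of 0] gain_nonneg by simp
next
  case False
  then have "real (dg x) \<le> 157 / 625 * b" using q_hi by linarith
  then have "2 * (b + 13 / 100 * b) \<le> (\<Sum>y\<in>nb x. transfer y x)"
    using receive_short[OF x, of "13 / 100 * b"] gain_ge b17 by simp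
  then show ?thesis using q_hi b17 by simp
qed

text \<open>Small vertices need not be low for \<open>x\<close> here, but heavy ones are. If
  \<open>t y \<le> b\<close>, then \<open>nS_bound\<close> leaves at most \<open>d - t y\<close>
  light neighbours at \<open>y\<close>, and what \<open>y\<close> sends is linear in
  \<open>1 / t y\<close>, so the sum of reciprocals applies again.\<close>

lemma receive_mid:
  assumes x: "b < real (dg x)" "real (dg x) \<le> 69 / 50 * b + 1"
  shows "q - dg x \<le> (\<Sum>y\<in>nb x. transfer y x)"
proof -
  define d where "d = real (dg x)"
  have d: "b < d" "d \<le> 69 / 50 * b + 1" using x by (simp_all add: d_def)
  have cX: "real (card (nb x)) = d" by (simp add: d_def dg_def)
  have hx: "heavy x" using x q_lo b17 by (simp add: heavy_def)
  have ne: "nb x \<noteq> {}" using d b17 by (auto simp: d_def dg_def)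
  have P: "dg u + dg x \<le> \<Delta>" if "heavy u" for u
  proof -
    have "real (dg u) < q - 19 / 50 * b" using that by (simp add: heavy_def)
    then have "real (dg u) + real (dg x) < real \<Delta> + 1" using x(2) b_def by linarith
    then show ?thesis by linarith
  qed
  define t where "t y = real (low_count heavy x y)" for y
  have key: "2 / 5 + (b - 2 / 5 * d) * (1 / t y) \<le> transfer y x" if y: "y \<in> nb x" and tb: "t y \<le> b" for y
  proof -
    have t: "t y = nH y + e y" unfolding t_def low_count_eq[of heavy, OF hx y] by (simp add: nH_def e_nat)
    have yx: "x \<in> nb y" using y nb_sym by blast
    have n1: "1 \<le> nH y" by (rule nH_pos[OF yx hx])
    have ns: "\<not> small y" using t tb n1 small_e[of y] by linarith
    obtain k :: nat where k: "real (nS y) + e y + 1 \<le> real (dg x) + k" "k * b + e y + 2 \<le> real (dg x)"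
      using nS_bound[OF heavy_small[OF hx] y] by blast
    have "k * b < 2 * b" using k(2) d e_nonneg[of y] b17 unfolding d_def by linarith
    then have "k \<le> 1" using b17 by simp
    then have L: "real (nL y) \<le> d - t y" using k(1) nS_split[of y] t by (simp add: d_def)
    have 1: "b / t y \<le> (b - e y) / nH y"
      using ratio_shift[of "e y" "t y" b] e_nonneg[of y] n1 tb t by simp
    have 2: "(b - 2 / 5 * (d - t y)) / b \<le> (b - 2 / 5 * nL y) / b"
      using L b17 by (intro divide_right_mono) auto
    have tp: "0 < t y" using t n1 e_nonneg[of y] by linarith
    have "0 \<le> b - 2 / 5 * (d - t y)"
      using d tp b17 by argo
    then have 3: "0 \<le> (b - 2 / 5 * (d - t y)) / b" using b17 by simp
    have "2 / 5 + (b - 2 / 5 * d) * (1 / t y) = b / t y * ((b - 2 / 5 * (d - t y)) / b)"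
      using tp b17 by (simp add: field_simps)
    also have "\<dots> \<le> (b - e y) / nH y * ((b - 2 / 5 * nL y) / b)"
      using 1 2 3 tp b17 small_e[of y] ns by (intro mult_mono) auto
    also have "\<dots> = (b - e y) * (b - 2 / 5 * nL y) / (b * nH y)" by (simp add: mult.commute)
    also have "\<dots> \<le> transfer y x" using transfer_heavy_ge(1)[OF hx yx ns] by simp
    finally show ?thesis .
  qed
  show ?thesis
  proof (cases "\<forall>y\<in>nb x. t y \<le> b")
    case True
    have "(\<Sum>y\<in>nb x. 2 / 5 + (b - 2 / 5 * d) * (1 / t y)) \<le> (\<Sum>y\<in>nb x. transfer y x)"
      using key True by (intro sum_mono) blast
    moreover have "(\<Sum>y\<in>nb x. 2 / 5 + (b - 2 / 5 * d) * (1 / t y))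
      = 2 / 5 * d + (b - 2 / 5 * d) * (\<Sum>y\<in>nb x. 1 / t y)"
      by (simp only: sum.distrib sum_distrib_left sum_constant cX)
    moreover have "(b - 2 / 5 * d) * 2 \<le> (b - 2 / 5 * d) * (\<Sum>y\<in>nb x. 1 / t y)"
      using sum_low_count[OF ne, of heavy] P d b17 unfolding t_def by (intro mult_left_mono) auto
    moreover have "(b - 2 / 5 * d) * 2 = 2 * b - 4 / 5 * d" by simp
    ultimately have "2 * b - 2 / 5 * d \<le> (\<Sum>y\<in>nb x. transfer y x)" by argo
    then show ?thesis using d q_hi b17 unfolding d_def[symmetric] by argo
  next
    case False
    then obtain y where "y \<in> nb x" "\<not> t y \<le> b" by blast
    then have y: "y \<in> nb x" "b < t y" by simp_all
    define Z where "Z = {z \<in> nb x - {y}. low_count heavy x y + low_count heavy x z \<le> dg x}"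
    have cZ: "t y \<le> card Z" unfolding t_def Z_def using low_count_le_card[OF y(1), of heavy] P by simp
    \<comment> \<open>More than \<open>b\<close> neighbours \<open>z\<close> have \<open>t z\<close>
      below \<open>d - b\<close>. The rate \<open>782 / 625 = 1407 / 625 - 1\<close> from each of
      them covers \<open>q - d\<close>, because \<open>d > b\<close>; \<open>532 / 625\<close> below
      is this rate less 2/5.\<close>
    have "(\<Sum>z\<in>Z. 782 / 625) + (real (card (nb x)) - real (card Z)) * 0 \<le> (\<Sum>y\<in>nb x. transfer y x)"
    proof (rule sum_split_ge[OF fin_nb])
      show "Z \<subseteq> nb x" by (auto simp: Z_def)
      show "0 \<le> transfer z x" if "z \<in> nb x" for z using transfer_nonneg that nb_sym by blast
      show "782 / 625 \<le> transfer z x" if z: "z \<in> Z" for z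
      proof -
        have tz: "t y + t z \<le> d" using z by (simp add: Z_def t_def d_def flip: of_nat_add)
        have tp: "0 < t z" by (simp add: t_def low_count_def)
        have "532 / 625 * t z \<le> b - 2 / 5 * d" using tz y(2) d b17 by linarith
        then have "532 / 625 \<le> (b - 2 / 5 * d) * (1 / t z)" using tp by (simp add: field_simps)
        moreover have "2 / 5 + (b - 2 / 5 * d) * (1 / t z) \<le> transfer z x"
          using z tz y(2) d b17 by (intro key) (auto simp: Z_def)
        ultimately show ?thesis by linarith
      qed
    qed
    then show ?thesis using cZ y(2) d q_hi by (simp add: d_def)
  qed
qed

text \<open>Everything rests on \<open>kierstead_set\<close> at a neighbour of maximum deficit
  \<open>m\<close>, as heavy vertices need not be low for such \<open>x\<close>. A small
  \<open>m\<close> keeps all deficits small; a large \<open>m\<close> makes \<open>B\<close> large,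
  with every member sending at least 1.\<close>

lemma receive_high:
  assumes hx: "heavy x" and x: "69 / 50 * b < real (dg x)"
  shows "q - dg x \<le> (\<Sum>y\<in>nb x. transfer y x)"
proof -
  define d where "d = real (dg x)"
  have d: "69 / 50 * b < d" "d < 2339 / 1250 * b" using x hx q_hi by (simp_all add: d_def heavy_def)
  have cX: "real (card (nb x)) = d" by (simp add: d_def dg_def)
  have ne: "nb x \<noteq> {}" using d b17 by (auto simp: d_def dg_def)
  obtain y where y: "y \<in> nb x" "\<And>z. z \<in> nb x \<Longrightarrow> e z \<le> e y" by (rule max_deficit[OF ne]) blast
  obtain B where B: "B \<subseteq> nb x - {y}" "card B + dg y = \<Delta> + 1"
    "(\<Sum>z\<in>B. \<Delta> - dg z) + (\<Delta> - dg y) + 2 \<le> dg x"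
    "dg y < \<Delta> \<Longrightarrow> z \<in> B \<Longrightarrow> card {u \<in> nb z - {x, y}. dg u + dg x + dg y \<le> 2 * \<Delta>}
        + (\<Delta> - dg z) + (\<Delta> - dg y) + 2 \<le> dg x" for z
    using kierstead_set[OF y(1)] by blast
  define m where "m = e y"
  have m0: "0 \<le> m" by (simp add: m_def e_nonneg)
  have cB: "real (card B) = m + 1" using B(2) dg_le[of y] unfolding m_def e_nat by linarith
  have "real (\<Sum>z\<in>B. \<Delta> - dg z) = (\<Sum>z\<in>B. e z)" by (simp add: e_nat)
  then have sB: "(\<Sum>z\<in>B. e z) + m + 2 \<le> d" using B(3) unfolding m_def e_nat[of y] d_def by linarith
  have md: "m + 2 \<le> d" using sB sum_nonneg[of B e] e_nonneg by force
  have BX: "B \<subseteq> nb x" using B(1) by blast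
  have low: "(b - e z) / (d - e z) \<le> transfer z x" if z: "z \<in> nb x" and ns: "\<not> small z" for z
  proof -
    have zx: "x \<in> nb z" using z nb_sym by blast
    obtain k :: nat where k: "real (nS z) + e z + 1 \<le> real (dg x) + k" "k * b + e z + 2 \<le> real (dg x)"
      using nS_bound[OF heavy_small[OF hx] z] by blast
    have "k * b < 2 * b" using k(2) d e_nonneg[of z] b17 unfolding d_def by linarith
    then have "k \<le> 1" using b17 by simp
    then have n: "real (nS z) \<le> d - e z" using k(1) by (simp add: d_def)
    have "1 \<le> nS z" by (rule nS_pos[OF zx heavy_small[OF hx]])
    then have "(b - e z) / (d - e z) \<le> (b - e z + gain z) / nS z"
      using n gain_nonneg[of z] ns small_e[of z] by (intro frac_le) auto
    also have "\<dots> \<le> transfer z x" by (rule transfer_heavy_ge(2)[OF hx zx ns])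
    finally show ?thesis .
  qed
  have low_m: "(b - m) / (d - m) \<le> transfer z x" if z: "z \<in> nb x" and m: "m < b" for z
  proof -
    have "e z \<le> m" using y(2)[OF z] by (simp add: m_def)
    then have "(b - m) / (d - m) \<le> (b - e z) / (d - e z)"
      using e_nonneg[of z] md d b17 by (intro ratio_shift_down) auto
    also have "\<dots> \<le> transfer z x" using low[OF z] \<open>e z \<le> m\<close> m small_e[of z] by simp
    finally show ?thesis .
  qed
  have rest: "b - m - 1 \<le> (d - (m + 1)) * ((b - m) / (d - m))"
    and rest': "b - m - b / d \<le> (d - (m + 1)) * ((b - m) / (d - m))" if m: "m < b"
  proof -
    have eq: "(d - (m + 1)) * ((b - m) / (d - m)) = b - m - (b - m) / (d - m)"
      using md by (simp add: field_simps)
    have "(b - m) / (d - m) \<le> b / d" using ratio_shift_down[of 0 m d b] m0 md d b17 by simp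
    moreover have "b / d \<le> 1" using d b17 by simp
    ultimately show "b - m - 1 \<le> (d - (m + 1)) * ((b - m) / (d - m))"
      "b - m - b / d \<le> (d - (m + 1)) * ((b - m) / (d - m))" using eq by linarith+
  qed
  show ?thesis
  proof (cases "m + 1 < d - b")
    case True
    have mb: "m < b" using True d b17 by simp
    \<comment> \<open>\<open>r\<close> is the negated slope in \<open>ratio_chord\<close>. A linear
      bound on \<open>B\<close> can be summed knowing only the total deficit.\<close>
    define r where "r = (d - b) / (d * (d - m))"
    have r0: "0 \<le> r" using d b17 md m0 by (simp add: r_def)
    have "(\<Sum>z\<in>B. b / d - e z * r) + (real (card (nb x)) - real (card B)) * ((b - m) / (d - m))
      \<le> (\<Sum>y\<in>nb x. transfer y x)"
    proof (rule sum_split_ge[OF fin_nb BX])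
      show "(b - m) / (d - m) \<le> transfer z x" if "z \<in> nb x" for z by (rule low_m[OF that mb])
      show "b / d - e z * r \<le> transfer z x" if z: "z \<in> B" for z
      proof -
        have zX: "z \<in> nb x" using z BX by blast
        have ez: "e z \<le> m" using y(2)[OF zX] by (simp add: m_def)
        have "b / d - e z * r \<le> (b - e z) / (d - e z)"
          unfolding r_def using ez e_nonneg[of z] md d b17 by (intro ratio_chord) auto
        also have "\<dots> \<le> transfer z x" using low[OF zX] ez mb small_e[of z] by simp
        finally show ?thesis .
      qed
    qed
    moreover have "(\<Sum>z\<in>B. b / d - e z * r) = (m + 1) * (b / d) - (\<Sum>z\<in>B. e z) * r"
      by (simp add: sum_subtractf sum_distrib_right cB)
    moreover have "(\<Sum>z\<in>B. e z) * r \<le> (d - m) * r" using sB r0 by (intro mult_right_mono) auto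
    moreover have "(d - m) * r = (d - b) / d" using md d b17 by (simp add: r_def)
    ultimately have T: "(m + 1) * (b / d) - (d - b) / d + (b - m - b / d) \<le> (\<Sum>y\<in>nb x. transfer y x)"
      using rest'[OF mb] unfolding cX cB by linarith
    have dp: "0 < d" using d b17 by linarith
    define X where "X = (m + 1) * (d - b) / d"
    have "b - X = (m + 1) * (b / d) - (d - b) / d + (b - m - b / d)"
      unfolding X_def using dp by (simp add: field_simps)
    with T have X: "b - X \<le> (\<Sum>y\<in>nb x. transfer y x)" by simp
    have "X \<le> (d - b) * (d - b) / d"
      unfolding X_def
      using True dp d b17 by (intro divide_right_mono mult_right_mono) auto
    also have "(d - b) * (d - b) / d \<le> b + d - q"
    proof -
      \<comment> \<open>Here \<open>468 / 625\<close> is \<open>3 - 1407 / 625\<close>, and its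
        product with \<open>69 / 50\<close> just exceeds 1.\<close>
      have "(69 / 50 * b) * (468 / 625 * b) \<le> d * (3 * b - q)"
        using d b17 q_hi by (intro mult_mono) auto
      moreover have "69 / 50 * b * (468 / 625 * b) = 69 / 50 * (468 / 625) * (b * b)" by simp
      moreover have "1 * (b * b) \<le> 69 / 50 * (468 / 625) * (b * b)" by (intro mult_right_mono) auto
      ultimately have "b * b \<le> d * (3 * b - q)" by linarith
      then have "(d - b) * (d - b) \<le> (b + d - q) * d" by (simp add: algebra_simps)
      then show ?thesis using dp by (simp add: divide_le_eq)
    qed
    finally have "X \<le> b + d - q" .
    then show ?thesis using X unfolding d_def[symmetric] by linarith
  next
    case False
    have ydeg: "dg y < \<Delta>" using False d b17 unfolding m_def e_nat by simp
    have one: "1 \<le> transfer z x" if z: "z \<in> B" for z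
    proof -
      have zX: "z \<in> nb x" and zx: "x \<in> nb z" using z BX nb_sym by blast+
      define C where "C = {u \<in> nb z - {x, y}. dg u + dg x + dg y \<le> 2 * \<Delta>}"
      have C: "real (card C) + e z + m + 2 \<le> d"
        using B(4)[OF ydeg z] unfolding C_def[symmetric] m_def e_nat d_def by linarith
      have ns: "\<not> small z"
      proof (cases "m \<le> b")
        case True then show ?thesis using y(2)[OF zX] small_e[of z] by (simp add: m_def)
      next
        case mb: False
        then show ?thesis using C d b17 small_e[of z] by simp
      qed
      have finC: "finite C" using fin_nb by (simp add: C_def)
      \<comment> \<open>\<open>m + 1 \<ge> d - b\<close> is what puts every small \<open>u\<close>
        under the degree bound of \<open>kierstead_set\<close>. Only \<open>x\<close> and
        \<open>y\<close> escape the count, and if \<open>y\<close> is small, then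
        \<open>m > b\<close> makes up for it.\<close>
      have sub: "u \<in> C" if u: "u \<in> nb z" "small u" "u \<noteq> x" "u \<noteq> y" for u
      proof -
        have "real (dg u) + dg x + dg y < 2 * real \<Delta> + 1"
          using u(2) False unfolding small_def b_def d_def m_def e_def by linarith
        then have "dg u + dg x + dg y \<le> 2 * \<Delta>" by linarith
        then show ?thesis using u by (simp add: C_def)
      qed
      have n: "nS z \<le> b - e z"
      proof (cases "small y")
        case True
        have "nS z \<le> card (insert x (insert y C))"
          unfolding nS_def using sub finC by (intro card_mono) auto
        also have "\<dots> \<le> 2 + card C" using finC by (simp add: card_insert_if)
        finally show ?thesis using C True small_e[of y] d unfolding m_def by simp
      next
        case sy: False
        have "nS z \<le> card (insert x C)" unfolding nS_def using sub sy finC by (intro card_mono) auto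
        also have "\<dots> \<le> 1 + card C" using finC by (simp add: card_insert_if)
        finally show ?thesis using C False by simp
      qed
      have "1 \<le> nS z" by (rule nS_pos[OF zx heavy_small[OF hx]])
      then have "1 \<le> (b - e z + gain z) / nS z" using n gain_nonneg[of z] by (simp add: le_divide_eq)
      also have "\<dots> \<le> transfer z x" by (rule transfer_heavy_ge(2)[OF hx zx ns])
      finally show ?thesis .
    qed
    have "b \<le> (\<Sum>y\<in>nb x. transfer y x)"
    proof (cases "m < b")
      case True
      have "(\<Sum>z\<in>B. 1) + (real (card (nb x)) - real (card B)) * ((b - m) / (d - m)) \<le> (\<Sum>y\<in>nb x. transfer y x)"
        by (rule sum_split_ge[OF fin_nb BX]) (use one low_m True in auto)
      then show ?thesis using rest[OF True] by (simp add: cX cB)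
    next
      case mb: False
      have "(\<Sum>z\<in>B. 1) + (real (card (nb x)) - real (card B)) * 0 \<le> (\<Sum>y\<in>nb x. transfer y x)"
        by (rule sum_split_ge[OF fin_nb BX]) (use one transfer_nonneg nb_sym in auto)
      then show ?thesis using mb by (simp add: cB)
    qed
    then show ?thesis using d q_hi b17 by (simp add: d_def)
  qed
qed

subsection \<open>Discharging\<close>

lemma receive_small:
  assumes "x \<in> V" "small x"
  shows "q - dg x \<le> (\<Sum>y\<in>nb x. transfer y x)"
proof (cases "heavy x")
  case True
  have ne: "nb x \<noteq> {}" using no_isolated assms by blast
  consider "real (dg x) \<le> b + 1" | "b < real (dg x)" "real (dg x) \<le> 69 / 50 * b + 1" | "69 / 50 * b < real (dg x)"
    using b17 by linarith
  then show ?thesis using receive_low[OF ne] receive_mid receive_high[OF True] by cases blast+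
qed (use receive_light assms in blast)

lemma final_charge:
  assumes "v \<in> V"
  shows "0 \<le> real (dg v) - q + (\<Sum>u\<in>nb v. transfer u v) - (\<Sum>u\<in>nb v. transfer v u)"
proof (cases "small v")
  case True
  then have "(\<Sum>u\<in>nb v. transfer v u) = 0" by (simp add: transfer_def)
  then show ?thesis using receive_small[OF assms True] by linarith
next
  case ns: False
  then have be: "0 \<le> b - e v" using small_e by simp
  \<comment> \<open>Free vertices send to every neighbour, so the amount \<open>gain v\<close> that
    \<open>v\<close> may pass on has really arrived.\<close>
  have "gain v = (\<Sum>u\<in>nb v. if free u then (real (dg u) - q) / dg u else 0)"
    unfolding gain_def using fin_nb by (simp add: sum.inter_filter)
  also have "\<dots> \<le> (\<Sum>u\<in>nb v. transfer u v)"
  proof (rule sum_mono)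
    fix u assume "u \<in> nb v"
    then have "0 \<le> transfer u v" using transfer_nonneg nb_sym by blast
    moreover have "transfer u v = (real (dg u) - q) / dg u" if "free u"
      using that by (simp add: transfer_def free_def)
    ultimately show "(if free u then (real (dg u) - q) / dg u else 0) \<le> transfer u v" by simp
  qed
  finally have inc: "gain v \<le> (\<Sum>u\<in>nb v. transfer u v)" .
  have "(\<Sum>u\<in>nb v. transfer v u) \<le> b - e v + gain v"
  proof (cases "free v")
    case True
    then have "(\<Sum>u\<in>nb v. transfer v u) = (\<Sum>u\<in>nb v. (real (dg v) - q) / dg v)"
      using ns by (intro sum.cong) (auto simp: transfer_def)
    also have "\<dots> = dg v * ((real (dg v) - q) / dg v)" by (simp add: dg_def)
    also have "\<dots> = b - e v" using ns q_lo b17 dg_q[of v] by (simp add: small_def)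
    finally show ?thesis using gain_nonneg[of v] by simp
  next
    case nf: False
    define H where "H = (b - e v + gain v - 2 / 5 * (b - e v) / b * nL v) / nH v"
    define L where "L = 2 / 5 * (b - e v) / b"
    have "(\<Sum>u\<in>nb v. transfer v u) = (\<Sum>u\<in>nb v. (if heavy u then H else 0) + (if small u \<and> \<not> heavy u then L else 0))"
      using ns nf heavy_small by (intro sum.cong) (auto simp: transfer_def H_def L_def)
    also have "\<dots> = nH v * H + nL v * L"
      using fin_nb[of v] by (simp add: sum.distrib sum.inter_filter[symmetric] nH_def nL_def)
    also have "\<dots> \<le> b - e v + gain v"
    proof (cases "nH v = 0")
      case True
      have "2 / 5 * nL v / b * (b - e v) \<le> 1 * (b - e v)"
        using nL_le[of v] be b17 by (intro mult_right_mono) (auto simp: divide_le_eq)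
      moreover have "nL v * L = 2 / 5 * nL v / b * (b - e v)" by (simp add: L_def)
      ultimately show ?thesis using True gain_nonneg[of v] by simp
    next
      case False
      then have "nH v * H = b - e v + gain v - 2 / 5 * (b - e v) / b * nL v" by (simp add: H_def)
      then show ?thesis by (simp add: L_def)
    qed
    finally show ?thesis .
  qed
  then show ?thesis using inc dg_q[of v] by linarith
qed

lemma degree_sum_ge: "q * card V \<le> (\<Sum>v\<in>V. real (dg v))"
proof -
  have nbV: "(\<Sum>u\<in>nb v. f u) = (\<Sum>u\<in>V. if u \<in> nb v then f u else 0)" for f :: "'a \<Rightarrow> real" and v
  proof -
    have "nb v = {u \<in> V. u \<in> nb v}" using nb_V by blast
    then have "(\<Sum>u\<in>nb v. f u) = (\<Sum>u\<in>{u \<in> V. u \<in> nb v}. f u)" by (rule sum.cong) (rule refl)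
    then show ?thesis by (simp only: sum.inter_filter[OF finV])
  qed
  have "(\<Sum>v\<in>V. \<Sum>u\<in>nb v. transfer u v) = (\<Sum>v\<in>V. \<Sum>u\<in>nb v. transfer v u)"
    unfolding nbV by (subst sum.swap) (simp add: nb_sym)
  moreover have "0 \<le> (\<Sum>v\<in>V. real (dg v) - q + (\<Sum>u\<in>nb v. transfer u v) - (\<Sum>u\<in>nb v. transfer v u))"
    by (intro sum_nonneg final_charge)
  ultimately show ?thesis by (simp add: sum.distrib sum_subtractf mult.commute)
qed

end

context critical_graph
begin

lemma handshake: "(\<Sum>v\<in>V. dg v) = 2 * card E"
proof -
  have "(\<Sum>v\<in>V. dg v) = (\<Sum>v\<in>V. \<Sum>e\<in>E. if v \<in> e then 1 else 0)"
    using finE by (simp add: vertex_degree_dg[symmetric] vertex_degree_def sum.inter_filter[symmetric])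
  also have "\<dots> = (\<Sum>e\<in>E. \<Sum>v\<in>V. if v \<in> e then 1 else 0)" by (rule sum.swap)
  also have "\<dots> = (\<Sum>e\<in>E. 2)"
  proof (rule sum.cong[OF refl])
    fix e assume e: "e \<in> E"
    have "{v \<in> V. v \<in> e} = e" using E_sub[OF e] by blast
    then show "(\<Sum>v\<in>V. if v \<in> e then 1 else 0) = (2::nat)"
      using E_card[OF e] finV by (simp add: sum.inter_filter[symmetric])
  qed
  finally show ?thesis by simp
qed

text \<open>The bounds of the theorem are instances. The first hypothesis absorbs additive constants
  in the estimates; it is closest to failing at \<open>\<Delta> = 56\<close>, where
  \<open>\<Delta> - q\<close> is about 17.3.\<close>

lemma average_degree_ge:
  fixes q :: real
  assumes "17 \<le> \<Delta> - q" "2 * (\<Delta> - q) \<le> q" "q \<le> 1407 / 625 * (\<Delta> - q)"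
  shows "q \<le> average_degree V E"
proof -
  interpret discharging V E \<Delta> q "\<Delta> - q" by unfold_locales (use assms in auto)
  have "V \<noteq> {}"
  proof
    assume "V = {}"
    then have "\<Delta> = 0" using critical by (simp add: edge_critical_def max_degree_def)
    then show False using assms by simp
  qed
  then have "0 < real (card V)" using finV by (simp add: card_gt_0_iff)
  moreover have "q * card V \<le> 2 * real (card E)"
    using degree_sum_ge unfolding of_nat_sum[symmetric] handshake by simp
  ultimately show ?thesis by (simp add: average_degree_def le_divide_eq)
qed

end

theorem theorem1:
  fixes V :: "'a set" and E :: "'a set set" and \<Delta> :: nat
  assumes "edge_critical \<Delta> V E"
  shows "(\<Delta> \<ge> 66 \<longrightarrow> average_degree V E \<ge> 0.69241 * real \<Delta> - 0.15658) \<and>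
         (\<Delta> = 65 \<longrightarrow> average_degree V E \<ge> 0.69392 * real \<Delta> - 0.20642) \<and>
         (56 \<le> \<Delta> \<and> \<Delta> \<le> 64 \<longrightarrow> average_degree V E \<ge> 0.68706 * real \<Delta> + 0.19815)"
proof -
  interpret critical_graph V E \<Delta> by unfold_locales (rule assms)
  show ?thesis
  proof (intro conjI impI)
    assume "66 \<le> \<Delta>"
    then have "66 \<le> real \<Delta>" by simp
    then show "0.69241 * real \<Delta> - 0.15658 \<le> average_degree V E"
      by (intro average_degree_ge) (simp_all add: field_simps)
  next
    assume "\<Delta> = 65"
    then show "0.69392 * real \<Delta> - 0.20642 \<le> average_degree V E"
      by (intro average_degree_ge) simp_all
  next
    assume "56 \<le> \<Delta> \<and> \<Delta> \<le> 64"
    then have "56 \<le> real \<Delta>" by simp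
    then show "0.68706 * real \<Delta> + 0.19815 \<le> average_degree V E"
      by (intro average_degree_ge) (simp_all add: field_simps)
  qed
qed

end
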